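(* Let $L\ge2$, let $\ell$ be either the exponential loss $\ell(x)=e^{-x}$ or the logistic loss $\ell(x)=\ln(1+e^{-x})$, and suppose Assumption 3 holds. Then for Lebesgue-almost every data set (i.e. with probability one if the data points are drawn from a distribution having a density with respect to Lebesgue measure), every gradient flow trajectory $W(t)$ whose initialization satisfies Assumption 2 satisfies $\lim_{t\to\infty}|\langle v_1(t),\bar u\rangle|=1$ and $$\lim_{t\to\infty}\frac{w_{\mathrm{prod}}(t)}{\prod_{k=1}^L\|W_k(t)\|_F}=\bar u .$$
   Context: Setting: data $(x_i,y_i)_{i=1}^n$ with $x_i\in\mathbb{R}^d$, $\|x_i\|\le 1$, $y_i\in\{-1,+1\}$; put $z_i:=y_ix_i$. The data are linearly separable, i.e. some unit vector $u$ has $\langle u,z_i\rangle>0$ for all $i$. Let $\gamma:=\max_{\|u\|=1}\min_{i}\langle u,z_i\rangle>0$ and let $\bar u$ be the unique unit vector attaining it (the maximum margin predictor). A depth-$L$ linear network is $W=(W_L,\dots,W_1)$ with $W_k\in\mathbb{R}^{d_k\times d_{k-1}}$, $d_0=d$, $d_L=1$, and $w_{\mathrm{prod}}:=(W_L\cdots W_1)^\top\in\mathbb{R}^d$. The risk is $\mathcal{R}(W)=\frac1n\sum_{i=1}^n\ell(\langle w_{\mathrm{prod}},z_i\rangle)$. Gradient flow: a $C^1$ curve $W(t)$, $t\in[0,\infty)$, with $\frac{d}{dt}W(t)=-\nabla\mathcal{R}(W(t))$. Assumption 2: $\nabla\mathcal{R}(W(0))\neq 0$ and $\mathcal{R}(W(0))\le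 \ell(0)$. Assumption 3: the support vectors, i.e. the $z_i$ with $\langle\bar u,z_i\rangle=\gamma$, span $\mathbb{R}^d$. $v_1(t)$ is a first (top) right unit singular vector of $W_1(t)$. *)

theory Defs
  imports "HOL-Analysis.Analysis"
begin

text \<open>
Conventions. The input dimension d is the finite type 'd (d = CARD('d)), the number of
samples n is the finite type 'n. A data set is X :: real^'d^'n (x_i = X$i), labels y :: 'n => real.
Widths: ds k for k = 1..L (ds 0 = d is implicit, ds L = 1).
The first layer W_1 (ds 1 x d) is stored by rows: W1 i :: real^'d for i < ds 1.
Layers k = 2..L are stored as W k i j (i < ds k, j < ds (k-1)).
\<close>

definition zvec :: "('n \<Rightarrow> real) \<Rightarrow> real^'d^'n \<Rightarrow> 'n \<Rightarrow> real^'d" where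
  "zvec y X i = y i *\<^sub>R (X $ i)"

definition separable :: "('n \<Rightarrow> real^'d) \<Rightarrow> bool" where
  "separable Z \<longleftrightarrow> (\<exists>u. norm u = 1 \<and> (\<forall>i. inner u (Z i) > 0))"

definition min_margin :: "('n::finite \<Rightarrow> real^'d) \<Rightarrow> real^'d \<Rightarrow> real" where
  "min_margin Z u = Min (range (\<lambda>i. inner u (Z i)))"

definition max_margin_dir :: "('n::finite \<Rightarrow> real^'d) \<Rightarrow> real^'d \<Rightarrow> bool" where
  "max_margin_dir Z u \<longleftrightarrow> norm u = 1 \<and> (\<forall>v. norm v = 1 \<longrightarrow> min_margin Z v \<le> min_margin Z u)"

definition support_vectors :: "('n::finite \<Rightarrow> real^'d) \<Rightarrow> real^'d \<Rightarrow> (real^'d) set" where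
  "support_vectors Z u = {Z i | i. inner u (Z i) = min_margin Z u}"

text \<open>Product W_k ... W_2 (a ds k x ds 1 matrix), for k >= 1; the empty product (k = 1) is the identity.\<close>
fun lprod :: "(nat \<Rightarrow> nat) \<Rightarrow> (nat \<Rightarrow> nat \<Rightarrow> nat \<Rightarrow> real) \<Rightarrow> nat \<Rightarrow> nat \<Rightarrow> nat \<Rightarrow> real" where
  "lprod ds W 0 i j = 0"
| "lprod ds W (Suc 0) i j = (if i = j then 1 else 0)"
| "lprod ds W (Suc (Suc k)) i j = (\<Sum>m<ds (Suc k). W (Suc (Suc k)) i m * lprod ds W (Suc k) m j)"

text \<open>w_prod = (W_L ... W_1)^T.\<close>
definition wprod :: "(nat \<Rightarrow> nat) \<Rightarrow> nat \<Rightarrow> (nat \<Rightarrow> real^'d) \<Rightarrow> (nat \<Rightarrow> nat \<Rightarrow> nat \<Rightarrow> real) \<Rightarrow> real^'d" where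
  "wprod ds L W1 W = (\<Sum>j<ds 1. lprod ds W L 0 j *\<^sub>R W1 j)"

definition risk :: "(real \<Rightarrow> real) \<Rightarrow> ('n::finite \<Rightarrow> real) \<Rightarrow> real^'d^'n \<Rightarrow> (nat \<Rightarrow> nat) \<Rightarrow> nat
   \<Rightarrow> (nat \<Rightarrow> real^'d) \<Rightarrow> (nat \<Rightarrow> nat \<Rightarrow> nat \<Rightarrow> real) \<Rightarrow> real" where
  "risk loss y X ds L W1 W = (1 / real CARD('n)) * (\<Sum>i\<in>UNIV. loss (inner (wprod ds L W1 W) (zvec y X i)))"

definition pd1 :: "(real \<Rightarrow> real) \<Rightarrow> ('n::finite \<Rightarrow> real) \<Rightarrow> real^'d^'n \<Rightarrow> (nat \<Rightarrow> nat) \<Rightarrow> nat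
   \<Rightarrow> (nat \<Rightarrow> real^'d) \<Rightarrow> (nat \<Rightarrow> nat \<Rightarrow> nat \<Rightarrow> real) \<Rightarrow> nat \<Rightarrow> 'd \<Rightarrow> real" where
  "pd1 loss y X ds L W1 W i j =
     deriv (\<lambda>s. risk loss y X ds L (W1(i := (\<chi> m. if m = j then s else W1 i $ m))) W) (W1 i $ j)"

definition pdk :: "(real \<Rightarrow> real) \<Rightarrow> ('n::finite \<Rightarrow> real) \<Rightarrow> real^'d^'n \<Rightarrow> (nat \<Rightarrow> nat) \<Rightarrow> nat
   \<Rightarrow> (nat \<Rightarrow> real^'d) \<Rightarrow> (nat \<Rightarrow> nat \<Rightarrow> nat \<Rightarrow> real) \<Rightarrow> nat \<Rightarrow> nat \<Rightarrow> nat \<Rightarrow> real" where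
  "pdk loss y X ds L W1 W k i j =
     deriv (\<lambda>s. risk loss y X ds L W1 (W(k := (W k)(i := (W k i)(j := s))))) (W k i j)"

definition grad_flow :: "(real \<Rightarrow> real) \<Rightarrow> ('n::finite \<Rightarrow> real) \<Rightarrow> real^'d^'n \<Rightarrow> (nat \<Rightarrow> nat) \<Rightarrow> nat
   \<Rightarrow> (real \<Rightarrow> nat \<Rightarrow> real^'d) \<Rightarrow> (real \<Rightarrow> nat \<Rightarrow> nat \<Rightarrow> nat \<Rightarrow> real) \<Rightarrow> bool" where
  "grad_flow loss y X ds L W1 W \<longleftrightarrow>
     (\<forall>t\<ge>0. \<forall>i<ds 1. \<forall>j.
        ((\<lambda>s. W1 s i $ j) has_real_derivative (- pd1 loss y X ds L (W1 t) (W t) i j)) (at t within {0..})) \<and>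
     (\<forall>t\<ge>0. \<forall>k\<in>{2..L}. \<forall>i<ds k. \<forall>j<ds (k - 1).
        ((\<lambda>s. W s k i j) has_real_derivative (- pdk loss y X ds L (W1 t) (W t) k i j)) (at t within {0..}))"

definition grad_nonzero :: "(real \<Rightarrow> real) \<Rightarrow> ('n::finite \<Rightarrow> real) \<Rightarrow> real^'d^'n \<Rightarrow> (nat \<Rightarrow> nat) \<Rightarrow> nat
   \<Rightarrow> (nat \<Rightarrow> real^'d) \<Rightarrow> (nat \<Rightarrow> nat \<Rightarrow> nat \<Rightarrow> real) \<Rightarrow> bool" where
  "grad_nonzero loss y X ds L W1 W \<longleftrightarrow>
     (\<exists>i<ds 1. \<exists>j. pd1 loss y X ds L W1 W i j \<noteq> 0) \<or>
     (\<exists>k\<in>{2..L}. \<exists>i<ds k. \<exists>j<ds (k - 1). pdk loss y X ds L W1 W k i j \<noteq> 0)"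

definition frob :: "(nat \<Rightarrow> nat) \<Rightarrow> (nat \<Rightarrow> real^'d) \<Rightarrow> (nat \<Rightarrow> nat \<Rightarrow> nat \<Rightarrow> real) \<Rightarrow> nat \<Rightarrow> real" where
  "frob ds W1 W k = (if k = 1 then sqrt (\<Sum>i<ds 1. (norm (W1 i))\<^sup>2)
                     else sqrt (\<Sum>i<ds k. \<Sum>j<ds (k - 1). (W k i j)\<^sup>2))"

text \<open>v is a first (top) right singular vector of W_1: a unit vector maximizing |W_1 v|.\<close>
definition top_rsv :: "(nat \<Rightarrow> nat) \<Rightarrow> (nat \<Rightarrow> real^'d) \<Rightarrow> real^'d \<Rightarrow> bool" where
  "top_rsv ds W1 v \<longleftrightarrow> norm v = 1 \<and>
     (\<forall>u. norm u = 1 \<longrightarrow> (\<Sum>i<ds 1. (inner (W1 i) u)\<^sup>2) \<le> (\<Sum>i<ds 1. (inner (W1 i) v)\<^sup>2))"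

end

(*
Write p_k = W_L ... W_{k+1}, w = w_prod and g for the gradient of the risk as a function of w.

Alignment.  The flow conserves W_{k+1}^T W_{k+1} - W_k W_k^T, so p_k is an eigenvector of W_k W_k^T for the
eigenvalue x = |W_L|^2 up to a relative error O(1/x) (downward induction on k, starting from the row W_L).
Hence |p_{k-1}|^2 = x |p_k|^2 (1 + O(1/x)), and |w| / prod_k |W_k|_F tends to 1 as x grows; no singular
value decomposition is needed.

Risk.  The risk decreases at rate at least |p_1|^2 |g|^2.  It drops below its value at w = 0, so w stays
away from 0, and |p_1| stays away from 0 (if x is bounded because |w| <= |W_1| |p_1|, if x is large by
alignment).  Since |g| is bounded below while the risk is, the risk tends to 0; all margins, and x, diverge.

Direction.  For generic data every vector orthogonal to the maximum margin direction u has a negative inner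
product with some support vector.  So if the component of w orthogonal to u is long, it has nonnegative inner
product with g, and the part of W_1 orthogonal to u does not grow.  By alignment this happens as soon as that
part is a fixed fraction of W_1, and |W_1| diverges, so the fraction tends to 0.

Generic data.  If a vector orthogonal to u is nonnegative on all support vectors, then, with T the set of
points having positive weight in the norm-minimal point p of the convex hull of the data, some support vector
outside T lies on the hyperplane through p orthogonal to p, which is determined by T alone.
*)

theory Submission
  imports Defs
begin

section \<open>Layer products and the gradient\<close>

text \<open>Counting factors from the left end lets a row be extended on the right: once
  \<open>n\<close> factors are taken, layer \<open>L - n\<close> comes next. \<open>bprod\<close>
  re-indexes this by the number of layers left out.\<close>

fun bprod_aux :: "(nat \<Rightarrow> nat) \<Rightarrow> nat \<Rightarrow> (nat \<Rightarrow> nat \<Rightarrow> nat \<Rightarrow> real) \<Rightarrow> nat \<Rightarrow> nat \<Rightarrow> real" where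
  "bprod_aux ds L W 0 i = (if i = 0 then 1 else 0)"
| "bprod_aux ds L W (Suc n) j = (\<Sum>i<ds (L - n). bprod_aux ds L W n i * W (L - n) i j)"

text \<open>The row vector \<open>W\<^sub>L \<cdots> W\<^sub>k\<^sub>+\<^sub>1\<close>, the empty product being the first unit vector.\<close>
definition bprod :: "(nat \<Rightarrow> nat) \<Rightarrow> nat \<Rightarrow> (nat \<Rightarrow> nat \<Rightarrow> nat \<Rightarrow> real) \<Rightarrow> nat \<Rightarrow> nat \<Rightarrow> real" where
  "bprod ds L W k = bprod_aux ds L W (L - k)"

text \<open>The rows of \<open>W\<^sub>k \<cdots> W\<^sub>1\<close>.\<close>
definition fprod :: "(nat \<Rightarrow> nat) \<Rightarrow> (nat \<Rightarrow> real^'d) \<Rightarrow> (nat \<Rightarrow> nat \<Rightarrow> nat \<Rightarrow> real) \<Rightarrow> nat \<Rightarrow> nat \<Rightarrow> real^'d" where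
  "fprod ds W1 W k i = (\<Sum>j<ds 1. lprod ds W k i j *\<^sub>R W1 j)"

lemma bprod_top: "bprod ds L W L i = (if i = 0 then 1 else 0)"
  by (simp add: bprod_def)

lemma bprod_step:
  assumes "k < L"
  shows "bprod ds L W k j = (\<Sum>i<ds (Suc k). bprod ds L W (Suc k) i * W (Suc k) i j)"
proof -
  have "L - k = Suc (L - Suc k)" "L - (L - Suc k) = Suc k" using assms by auto
  then show ?thesis by (simp add: bprod_def)
qed

lemma fprod_one: "i < ds 1 \<Longrightarrow> fprod ds W1 W 1 i = W1 i"
  by (simp add: fprod_def if_distrib[where f = "\<lambda>x. x *\<^sub>R _"] cong: if_cong)

lemma fprod_step:
  assumes "k \<ge> 1"
  shows "fprod ds W1 W (Suc k) i = (\<Sum>m<ds k. W (Suc k) i m *\<^sub>R fprod ds W1 W k m)"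
proof -
  obtain k' where k: "k = Suc k'" using assms by (cases k) auto
  show ?thesis unfolding k fprod_def lprod.simps scaleR_sum_left scaleR_sum_right
    by (subst sum.swap) (simp add: k)
qed

lemma wprod_fprod: "wprod ds L W1 W = fprod ds W1 W L 0"
  by (simp add: wprod_def fprod_def)

text \<open>The cut can be moved down one layer because W_{k+1} may be absorbed on either side of
  it. This isolates the dependence of the product on a single layer.\<close>

lemma wprod_split:
  assumes "1 \<le> k" "k \<le> L" "ds L = 1"
  shows "wprod ds L W1 W = (\<Sum>i<ds k. bprod ds L W k i *\<^sub>R fprod ds W1 W k i)"
  using assms(2,1)
proof (induction k rule: inc_induct)
  case base
  then show ?case by (simp add: wprod_fprod bprod_top assms(3))
next
  case (step k)
  have "(\<Sum>i<ds k. bprod ds L W k i *\<^sub>R fprod ds W1 W k i)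
    = (\<Sum>i<ds k. \<Sum>m<ds (Suc k). (bprod ds L W (Suc k) m * W (Suc k) m i) *\<^sub>R fprod ds W1 W k i)"
    using step.hyps by (simp add: bprod_step scaleR_sum_left)
  also have "\<dots> = (\<Sum>m<ds (Suc k). bprod ds L W (Suc k) m *\<^sub>R fprod ds W1 W (Suc k) m)"
    using step.prems by (subst sum.swap) (simp add: fprod_step scaleR_sum_right)
  finally show ?case using step by simp
qed

lemma wprod_one:
  assumes "1 \<le> L" "ds L = 1"
  shows "wprod ds L W1 W = (\<Sum>i<ds 1. bprod ds L W 1 i *\<^sub>R W1 i)"
  using wprod_split[of 1 L ds W1 W] assms by (simp add: fprod_one[simplified])

text \<open>The row p_k involves the layers above \<open>k\<close> only, so perturbing layer
  \<open>k\<close> does not change it; \<open>fprod_cong\<close> is the counterpart for the layers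
  below.\<close>

lemma bprod_cong:
  assumes "k \<le> L" "\<And>m. k < m \<Longrightarrow> m \<le> L \<Longrightarrow> W m = W' m"
  shows "bprod ds L W k i = bprod ds L W' k i"
  using assms
proof (induction k arbitrary: i rule: inc_induct)
  case base
  then show ?case by (simp add: bprod_top)
next
  case (step k)
  then show ?case by (simp add: bprod_step)
qed

lemma fprod_cong:
  assumes "1 \<le> k" "\<And>m. 1 < m \<Longrightarrow> m \<le> k \<Longrightarrow> W m = W' m" "i < ds k"
  shows "fprod ds W1 W k i = fprod ds W1 W' k i"
  using assms
proof (induction k arbitrary: i rule: dec_induct)
  case base
  then show ?case by (simp add: fprod_one[simplified])
next
  case (step k)
  then show ?case by (simp add: fprod_step)
qed

text \<open>With \<open>c\<close> minus the derivative of the loss, this is the gradient of the mean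
  loss as a function of the product vector alone.\<close>

definition drisk :: "(real \<Rightarrow> real) \<Rightarrow> ('n::finite \<Rightarrow> real^'d) \<Rightarrow> real^'d \<Rightarrow> real^'d" where
  "drisk c Z w = - (1 / real CARD('n)) *\<^sub>R (\<Sum>i\<in>UNIV. c (inner w (Z i)) *\<^sub>R Z i)"

lemma inner_drisk:
  "inner v (drisk c (Z :: 'n::finite \<Rightarrow> real^'d) w) = - (1 / real CARD('n)) * (\<Sum>i\<in>UNIV. c (inner w (Z i)) * inner v (Z i))"
  by (simp add: drisk_def inner_sum_right)

text \<open>Chain rule along an arbitrary curve, used both for single-entry perturbations and for
  the flow in time; hence the derivative within a set \<open>A\<close>.\<close>

lemma has_derivative_mean_loss:
  fixes Z :: "'n::finite \<Rightarrow> real^'d"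
  assumes c: "\<And>x. (loss has_real_derivative - c x) (at x)"
    and w: "(w has_vector_derivative w') (at t within A)"
  shows "((\<lambda>s. (1 / real CARD('n)) * (\<Sum>i\<in>UNIV. loss (inner (w s) (Z i)))) has_real_derivative
     inner w' (drisk c Z (w t))) (at t within A)"
proof -
  have 1: "((\<lambda>s. inner (w s) (Z i)) has_real_derivative inner w' (Z i)) (at t within A)" for i
    using bounded_linear.has_vector_derivative[OF bounded_linear_inner_left w, of "Z i"]
    by (simp add: has_real_derivative_iff_has_vector_derivative)
  have "((\<lambda>s. loss (inner (w s) (Z i))) has_real_derivative (- c (inner (w t) (Z i))) * inner w' (Z i)) (at t within A)" for i
    by (rule DERIV_chain2[OF c 1])
  then have "((\<lambda>s. (1 / real CARD('n)) * (\<Sum>i\<in>UNIV. loss (inner (w s) (Z i)))) has_real_derivative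
     (1 / real CARD('n)) * (\<Sum>i\<in>UNIV. (- c (inner (w t) (Z i))) * inner w' (Z i))) (at t within A)"
    by (intro DERIV_cmult DERIV_sum) auto
  then show ?thesis by (simp add: inner_drisk sum_negf)
qed

lemma pd1_eq:
  fixes X :: "real^'d^'n::finite"
  assumes c: "\<And>x. (loss has_real_derivative - c x) (at x)"
    and L: "1 \<le> L" "ds L = 1" and i: "i < ds 1"
  shows "pd1 loss y X ds L W1 W i j = bprod ds L W 1 i * drisk c (zvec y X) (wprod ds L W1 W) $ j"
proof -
  let ?u = "\<lambda>s. W1(i := (\<chi> m. if m = j then s else W1 i $ m))"
  have u: "?u s k = W1 k + (if k = i then (s - W1 i $ j) *\<^sub>R axis j 1 else 0)" for s k
    by (auto simp: vec_eq_iff axis_def)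
  \<comment> \<open>The product is affine in a single entry, so its derivative can be read
    off.\<close>
  have w: "wprod ds L (?u s) W = wprod ds L W1 W + (s - W1 i $ j) *\<^sub>R (bprod ds L W 1 i *\<^sub>R axis j 1)" for s
    unfolding wprod_one[of L ds, OF L] u scaleR_add_right sum.distrib using i
    by (simp add: if_distrib[where f = "\<lambda>x. _ *\<^sub>R x"] cong: if_cong)
  have "((\<lambda>s. wprod ds L (?u s) W) has_vector_derivative bprod ds L W 1 i *\<^sub>R axis j 1) (at (W1 i $ j))"
    unfolding w by (auto intro!: derivative_eq_intros)
  from has_derivative_mean_loss[of loss c, OF c this, of "zvec y X"]
  have "((\<lambda>s. risk loss y X ds L (?u s) W) has_real_derivative
     inner (bprod ds L W 1 i *\<^sub>R axis j 1) (drisk c (zvec y X) (wprod ds L W1 W))) (at (W1 i $ j))"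
    unfolding risk_def w by simp
  then show ?thesis unfolding pd1_def by (simp add: DERIV_imp_deriv inner_axis')
qed

lemma pdk_eq:
  fixes X :: "real^'d^'n::finite"
  assumes c: "\<And>x. (loss has_real_derivative - c x) (at x)"
    and L: "ds L = 1" and k: "2 \<le> k" "k \<le> L" and i: "i < ds k" and j: "j < ds (k - 1)"
  shows "pdk loss y X ds L W1 W k i j =
    bprod ds L W k i * inner (fprod ds W1 W (k - 1) j) (drisk c (zvec y X) (wprod ds L W1 W))"
proof -
  let ?u = "\<lambda>s. W(k := (W k)(i := (W k i)(j := s)))"
  obtain l where l: "k = Suc l" "l \<ge> 1" using k by (cases k) auto
  \<comment> \<open>Perturbing layer \<open>k\<close> changes neither the row above it nor the
    partial product below it, so the full product is again affine in the entry.\<close>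
  have p: "bprod ds L (?u s) k m = bprod ds L W k m" for s m
    using k by (intro bprod_cong) auto
  have q: "m < ds l \<Longrightarrow> fprod ds W1 (?u s) l m = fprod ds W1 W l m" for s m
    using l by (intro fprod_cong) auto
  have u: "?u s k a m = W k a m + (if m = j then (if a = i then s - W k i j else 0) else 0)" for s a m
    by auto
  have f: "fprod ds W1 (?u s) k a = fprod ds W1 W k a + (if a = i then (s - W k i j) *\<^sub>R fprod ds W1 W l j else 0)" for s a
  proof -
    have "fprod ds W1 (?u s) k a = (\<Sum>m<ds l. ?u s k a m *\<^sub>R fprod ds W1 W l m)"
      unfolding l(1) fprod_step[OF l(2)] using q unfolding l(1) by simp
    also have "\<dots> = (\<Sum>m<ds l. W k a m *\<^sub>R fprod ds W1 W l m) + (\<Sum>m<ds l. (if m = j then (if a = i then s - W k i j else 0) else 0) *\<^sub>R fprod ds W1 W l m)"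
      unfolding u scaleR_add_left sum.distrib by simp
    also have "(\<Sum>m<ds l. (if m = j then (if a = i then s - W k i j else 0) else 0) *\<^sub>R fprod ds W1 W l m)
       = (if a = i then (s - W k i j) *\<^sub>R fprod ds W1 W l j else 0)"
      using j l by (simp add: if_distrib[where f = "\<lambda>x. x *\<^sub>R _"] cong: if_cong)
    finally show ?thesis unfolding l(1) fprod_step[OF l(2)] .
  qed
  have w: "wprod ds L W1 (?u s) = wprod ds L W1 W + (s - W k i j) *\<^sub>R (bprod ds L W k i *\<^sub>R fprod ds W1 W l j)" for s
  proof -
    have "wprod ds L W1 (?u s) = (\<Sum>a<ds k. bprod ds L W k a *\<^sub>R fprod ds W1 (?u s) k a)"
      using wprod_split[of k L ds W1 "?u s"] k L unfolding p by simp
    also have "\<dots> = wprod ds L W1 W + (\<Sum>a<ds k. bprod ds L W k a *\<^sub>R (if a = i then (s - W k i j) *\<^sub>R fprod ds W1 W l j else 0))"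
      unfolding f scaleR_add_right sum.distrib using wprod_split[of k L ds W1 W] k L by simp
    finally show ?thesis using i
      by (simp add: if_distrib[where f = "\<lambda>x. _ *\<^sub>R x"] mult.commute cong: if_cong)
  qed
  have "((\<lambda>s. wprod ds L W1 (?u s)) has_vector_derivative bprod ds L W k i *\<^sub>R fprod ds W1 W l j) (at (W k i j))"
    unfolding w by (auto intro!: derivative_eq_intros)
  from has_derivative_mean_loss[of loss c, OF c this, of "zvec y X"]
  have "((\<lambda>s. risk loss y X ds L W1 (?u s)) has_real_derivative
     inner (bprod ds L W k i *\<^sub>R fprod ds W1 W l j) (drisk c (zvec y X) (wprod ds L W1 W))) (at (W k i j))"
    unfolding risk_def w by simp
  then show ?thesis unfolding pdk_def by (simp add: DERIV_imp_deriv l)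
qed

section \<open>Balancedness of the flow\<close>

lemma sum_square_mult:
  fixes p :: "nat \<Rightarrow> real"
  shows "(\<Sum>j<m. (\<Sum>i<n. p i * M i j)\<^sup>2) = (\<Sum>i<n. p i * (\<Sum>i'<n. (\<Sum>j<m. M i j * M i' j) * p i'))"
proof -
  have "(\<Sum>j<m. (\<Sum>i<n. p i * M i j)\<^sup>2) = (\<Sum>j<m. \<Sum>i<n. \<Sum>i'<n. (p i * M i j) * (p i' * M i' j))"
    by (simp add: power2_eq_square sum_product)
  also have "\<dots> = (\<Sum>i<n. \<Sum>j<m. \<Sum>i'<n. (p i * M i j) * (p i' * M i' j))"
    by (rule sum.swap)
  also have "\<dots> = (\<Sum>i<n. \<Sum>i'<n. \<Sum>j<m. (p i * M i j) * (p i' * M i' j))"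
    by (intro sum.cong refl sum.swap)
  also have "\<dots> = (\<Sum>i<n. p i * (\<Sum>i'<n. (\<Sum>j<m. M i j * M i' j) * p i'))"
    by (simp add: sum_distrib_left sum_distrib_right mult_ac)
  finally show ?thesis .
qed

lemma sum_square_mult_le:
  fixes p :: "nat \<Rightarrow> real"
  shows "(\<Sum>j<m. (\<Sum>i<n. p i * M i j)\<^sup>2) \<le> (\<Sum>i<n. (p i)\<^sup>2) * (\<Sum>i<n. \<Sum>j<m. (M i j)\<^sup>2)"
proof -
  have "(\<Sum>j<m. (\<Sum>i<n. p i * M i j)\<^sup>2) \<le> (\<Sum>j<m. (\<Sum>i<n. (p i)\<^sup>2) * (\<Sum>i<n. (M i j)\<^sup>2))"
    by (intro sum_mono Cauchy_Schwarz_ineq_sum)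
  also have "\<dots> = (\<Sum>i<n. (p i)\<^sup>2) * (\<Sum>i<n. \<Sum>j<m. (M i j)\<^sup>2)"
    by (subst sum.swap) (simp add: sum_distrib_left)
  finally show ?thesis .
qed

lemma norm_sum_scaleR_square_le:
  fixes p :: "nat \<Rightarrow> real" and v :: "nat \<Rightarrow> 'a::real_inner"
  shows "(norm (\<Sum>i<n. p i *\<^sub>R v i))\<^sup>2 \<le> (\<Sum>i<n. (p i)\<^sup>2) * (\<Sum>i<n. (norm (v i))\<^sup>2)"
proof -
  have "norm (\<Sum>i<n. p i *\<^sub>R v i) \<le> (\<Sum>i<n. \<bar>p i\<bar> * norm (v i))"
    by (rule order_trans[OF norm_sum]) simp
  then have "(norm (\<Sum>i<n. p i *\<^sub>R v i))\<^sup>2 \<le> (\<Sum>i<n. \<bar>p i\<bar> * norm (v i))\<^sup>2"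
    by (intro power_mono) auto
  also have "\<dots> \<le> (\<Sum>i<n. (\<bar>p i\<bar>)\<^sup>2) * (\<Sum>i<n. (norm (v i))\<^sup>2)"
    by (rule Cauchy_Schwarz_ineq_sum)
  finally show ?thesis by simp
qed

lemma norm_sum_scaleR_square:
  fixes p :: "nat \<Rightarrow> real" and v :: "nat \<Rightarrow> 'a::real_inner"
  shows "(norm (\<Sum>i<n. p i *\<^sub>R v i))\<^sup>2 = (\<Sum>i<n. p i * (\<Sum>j<n. inner (v i) (v j) * p j))"
  unfolding power2_norm_eq_inner inner_sum_left inner_sum_right
  by (simp add: sum_distrib_left mult_ac inner_commute)

text \<open>Here \<open>g\<close> is an arbitrary function of time: conservation and alignment
  follow from the shape of the layer derivatives, whatever the loss. Derivatives within
  \<open>{0..}\<close> are one-sided at time 0.\<close>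

locale deep_linear_flow =
  fixes L :: nat and ds :: "nat \<Rightarrow> nat"
    and W1 :: "real \<Rightarrow> nat \<Rightarrow> real^'d" and W :: "real \<Rightarrow> nat \<Rightarrow> nat \<Rightarrow> nat \<Rightarrow> real"
    and g :: "real \<Rightarrow> real^'d"
  assumes L_ge: "2 \<le> L" and ds_top: "ds L = 1"
    and W1_deriv: "0 \<le> t \<Longrightarrow> i < ds 1 \<Longrightarrow>
      ((\<lambda>s. W1 s i) has_vector_derivative - bprod ds L (W t) 1 i *\<^sub>R g t) (at t within {0..})"
    and W_deriv: "0 \<le> t \<Longrightarrow> 2 \<le> k \<Longrightarrow> k \<le> L \<Longrightarrow> i < ds k \<Longrightarrow> j < ds (k - 1) \<Longrightarrow>
      ((\<lambda>s. W s k i j) has_real_derivative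
        - (bprod ds L (W t) k i * inner (fprod ds (W1 t) (W t) (k - 1) j) (g t))) (at t within {0..})"
begin

abbreviation "p t \<equiv> bprod ds L (W t)"
abbreviation "q t \<equiv> fprod ds (W1 t) (W t)"
abbreviation "w t \<equiv> wprod ds L (W1 t) (W t)"

section \<open>Velocity of the partial products\<close>

definition "p_sq t k = (\<Sum>i<ds k. (p t k i)\<^sup>2)"

lemma p_sq_nonneg: "0 \<le> p_sq t k"
  unfolding p_sq_def by (intro sum_nonneg) auto

text \<open>Pairing the velocities of the rows with p_k makes the induction close, because p_{k+1}
  W_{k+1} = p_k; each layer then contributes one square. For \<open>k = L\<close> the pairing is the
  inner product of the velocity of \<open>w\<close> with \<open>g\<close>.\<close>

lemma q_deriv:
  assumes "0 \<le> t" "1 \<le> k" "k \<le> L"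
  shows "\<exists>q'. (\<forall>i<ds k. ((\<lambda>s. q s k i) has_vector_derivative q' i) (at t within {0..})) \<and>
     (\<Sum>i<ds k. p t k i * inner (q' i) (g t)) =
       - (p_sq t 1 * (norm (g t))\<^sup>2) - (\<Sum>l\<in>{2..k}. p_sq t l * (\<Sum>j<ds (l - 1). (inner (q t (l - 1) j) (g t))\<^sup>2))"
  using assms(2,3)
proof (induction k rule: dec_induct)
  case base
  have "((\<lambda>s. q s 1 i) has_vector_derivative - p t 1 i *\<^sub>R g t) (at t within {0..})" if "i < ds 1" for i
    using W1_deriv[OF assms(1) that] that by (simp add: fprod_one[simplified])
  moreover have "(\<Sum>i<ds 1. p t 1 i * inner (- p t 1 i *\<^sub>R g t) (g t)) = - (p_sq t 1 * (norm (g t))\<^sup>2)"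
    unfolding power2_norm_eq_inner by (simp add: p_sq_def sum_distrib_left sum_negf power2_eq_square mult_ac)
  ultimately show ?case by (intro exI[of _ "\<lambda>i. - p t 1 i *\<^sub>R g t"]) auto
next
  case (step k)
  from step.IH step.prems obtain q' where
    d: "\<And>i. i < ds k \<Longrightarrow> ((\<lambda>s. q s k i) has_vector_derivative q' i) (at t within {0..})" and
    e: "(\<Sum>i<ds k. p t k i * inner (q' i) (g t)) =
       - (p_sq t 1 * (norm (g t))\<^sup>2) - (\<Sum>l\<in>{2..k}. p_sq t l * (\<Sum>j<ds (l - 1). (inner (q t (l - 1) j) (g t))\<^sup>2))"
    by auto
  \<comment> \<open>Product rule for W_{k+1} times the rows \<open>q t k\<close>, with the flow
    equation inserted for the derivative of W_{k+1}.\<close>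
  define r where "r i = (\<Sum>m<ds k. W t (Suc k) i m *\<^sub>R q' m + (- (p t (Suc k) i * inner (q t k m) (g t))) *\<^sub>R q t k m)" for i
  have "((\<lambda>s. q s (Suc k) i) has_vector_derivative r i) (at t within {0..})" if i: "i < ds (Suc k)" for i
    unfolding fprod_step[OF step.hyps(1)] r_def
    using W_deriv[of t "Suc k" i] assms i step
    by (intro has_vector_derivative_sum has_vector_derivative_scaleR d) auto
  moreover have "(\<Sum>i<ds (Suc k). p t (Suc k) i * inner (r i) (g t)) =
     (\<Sum>i<ds k. p t k i * inner (q' i) (g t)) - p_sq t (Suc k) * (\<Sum>j<ds k. (inner (q t k j) (g t))\<^sup>2)"
  proof -
    have "(\<Sum>i<ds (Suc k). p t (Suc k) i * inner (r i) (g t)) =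
       (\<Sum>i<ds (Suc k). \<Sum>m<ds k. p t (Suc k) i * W t (Suc k) i m * inner (q' m) (g t))
        - (\<Sum>i<ds (Suc k). \<Sum>m<ds k. (p t (Suc k) i)\<^sup>2 * (inner (q t k m) (g t))\<^sup>2)"
      by (simp add: r_def inner_sum_left inner_add_left inner_diff_left sum.distrib sum_subtractf sum_distrib_left power2_eq_square
         algebra_simps)
    also have "(\<Sum>i<ds (Suc k). \<Sum>m<ds k. p t (Suc k) i * W t (Suc k) i m * inner (q' m) (g t))
       = (\<Sum>i<ds k. p t k i * inner (q' i) (g t))"
      using step.hyps step.prems by (subst sum.swap) (simp add: bprod_step sum_distrib_right)
    finally show ?thesis by (simp add: p_sq_def sum_product)
  qed
  moreover have "{2..Suc k} = insert (Suc k) {2..k}" using step.hyps by auto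
  ultimately show ?case unfolding e by (intro exI[of _ r]) (auto simp: algebra_simps)
qed

lemma w_deriv:
  assumes "0 \<le> t"
  obtains w' where "(w has_vector_derivative w') (at t within {0..})"
    "inner w' (g t) = - (p_sq t 1 * (norm (g t))\<^sup>2)
       - (\<Sum>k\<in>{2..L}. p_sq t k * (\<Sum>j<ds (k - 1). (inner (q t (k - 1) j) (g t))\<^sup>2))"
  using q_deriv[OF assms, of L] L_ge ds_top
  by (auto simp: wprod_fprod bprod_top)

text \<open>\<open>gram t k = W\<^sub>k W\<^sub>k\<^sup>T\<close> and \<open>cogram t k = W\<^sub>k\<^sup>T W\<^sub>k\<close>; the flow conserves the difference of
  \<open>cogram t (k + 1)\<close> and \<open>gram t k\<close>.\<close>
definition "gram t k a b =
  (if k = 1 then inner (W1 t a) (W1 t b) else (\<Sum>j<ds (k - 1). W t k a j * W t k b j))"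
definition "cogram t k a b = (\<Sum>i<ds k. W t k i a * W t k i b)"
definition "imb k a b = cogram 0 (Suc k) a b - gram 0 k a b"

text \<open>The flow moves layer \<open>k\<close> by a rank-one matrix with left factor p_k, and
  multiplying its right factor by the layer gives the pairings of \<open>q t k\<close> with
  \<open>g t\<close>. \<open>cogram_deriv\<close> reaches the same symmetric expression, there
  through p_{k+1} W_{k+1} = p_k.\<close>

lemma gram_deriv:
  assumes "0 \<le> t" "1 \<le> k" "k \<le> L" "a < ds k" "b < ds k"
  shows "((\<lambda>s. gram s k a b) has_real_derivative
     - (p t k a * inner (q t k b) (g t) + p t k b * inner (q t k a) (g t))) (at t within {0..})"
proof (cases "k = 1")
  case True
  have "((\<lambda>s. inner (W1 s a) (W1 s b)) has_vector_derivative
     (inner (W1 t a) (- p t 1 b *\<^sub>R g t) + inner (- p t 1 a *\<^sub>R g t) (W1 t b))) (at t within {0..})"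
    using W1_deriv[OF assms(1)] assms True
    by (intro bounded_bilinear.has_vector_derivative[OF bounded_bilinear_inner]) auto
  then show ?thesis using True assms
    by (simp add: gram_def has_real_derivative_iff_has_vector_derivative fprod_one[simplified] inner_commute algebra_simps)
next
  case False
  then obtain l where l: "k = Suc l" "1 \<le> l" using assms by (cases k) auto
  have q: "inner (q t k i) (g t) = (\<Sum>j<ds l. W t k i j * inner (q t l j) (g t))" for i
    unfolding l fprod_step[OF l(2)] by (simp add: inner_sum_left)
  have "((\<lambda>s. \<Sum>j<ds l. W s k a j * W s k b j) has_real_derivative
     (\<Sum>j<ds l. - (p t k a * inner (q t l j) (g t)) * W t k b j + - (p t k b * inner (q t l j) (g t)) * W t k a j)) (at t within {0..})"
    using W_deriv[of t k] assms l by (intro DERIV_sum DERIV_mult) auto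
  moreover have "(\<Sum>j<ds l. - (p t k a * inner (q t l j) (g t)) * W t k b j + - (p t k b * inner (q t l j) (g t)) * W t k a j)
    = - (p t k a * inner (q t k b) (g t) + p t k b * inner (q t k a) (g t))"
    unfolding q by (simp add: sum.distrib sum_subtractf sum_negf sum_distrib_left algebra_simps)
  ultimately show ?thesis using False l by (simp add: gram_def)
qed

lemma cogram_deriv:
  assumes "0 \<le> t" "1 \<le> k" "k < L" "a < ds k" "b < ds k"
  shows "((\<lambda>s. cogram s (Suc k) a b) has_real_derivative
     - (p t k a * inner (q t k b) (g t) + p t k b * inner (q t k a) (g t))) (at t within {0..})"
proof -
  let ?k = "Suc k"
  have "((\<lambda>s. \<Sum>i<ds ?k. W s ?k i a * W s ?k i b) has_real_derivative
     (\<Sum>i<ds ?k. - (p t ?k i * inner (q t k a) (g t)) * W t ?k i b + - (p t ?k i * inner (q t k b) (g t)) * W t ?k i a)) (at t within {0..})"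
    using W_deriv[of t ?k] assms by (intro DERIV_sum DERIV_mult) auto
  moreover have "(\<Sum>i<ds ?k. - (p t ?k i * inner (q t k a) (g t)) * W t ?k i b + - (p t ?k i * inner (q t k b) (g t)) * W t ?k i a)
    = - (p t k a * inner (q t k b) (g t) + p t k b * inner (q t k a) (g t))"
    unfolding bprod_step[OF assms(3)]
    by (simp add: sum.distrib sum_subtractf sum_negf sum_distrib_left sum_distrib_right algebra_simps)
  ultimately show ?thesis by (simp add: cogram_def)
qed

lemma cogram_eq:
  assumes "0 \<le> t" "1 \<le> k" "k < L" "a < ds k" "b < ds k"
  shows "cogram t (Suc k) a b = gram t k a b + imb k a b"
proof -
  have "((\<lambda>s. cogram s (Suc k) a b - gram s k a b) has_real_derivative 0) (at s within {0..})" if "s \<in> {0..}" for s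
    using DERIV_diff[OF cogram_deriv[of s k a b] gram_deriv[of s k a b]] assms that by simp
  from has_field_derivative_zero_constant[OF _ this] obtain c
    where c: "\<And>s. s \<ge> 0 \<Longrightarrow> cogram s (Suc k) a b - gram s k a b = c" by auto
  show ?thesis using c[OF assms(1)] c[of 0] by (simp add: imb_def)
qed

section \<open>Squared Frobenius norms of the layers\<close>

definition "frob_sq t k = (\<Sum>a<ds k. gram t k a a)"

lemma frob_sq_one: "frob_sq t 1 = (\<Sum>i<ds 1. (norm (W1 t i))\<^sup>2)"
  by (simp add: frob_sq_def gram_def power2_norm_eq_inner)

lemma frob_sq_gt_one: "k \<noteq> 1 \<Longrightarrow> frob_sq t k = (\<Sum>i<ds k. \<Sum>j<ds (k - 1). (W t k i j)\<^sup>2)"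
  by (simp add: frob_sq_def gram_def power2_eq_square)

lemma frob_sq_nonneg: "0 \<le> frob_sq t k"
  by (cases "k = 1") (auto simp: frob_sq_one[simplified] frob_sq_gt_one intro!: sum_nonneg)

lemma frob_eq: "frob ds (W1 t) (W t) k = sqrt (frob_sq t k)"
  by (cases "k = 1") (simp_all add: frob_def frob_sq_one[simplified] frob_sq_gt_one)

lemma frob_sq_Suc:
  assumes "0 \<le> t" "1 \<le> k" "k < L"
  shows "frob_sq t (Suc k) = frob_sq t k + (\<Sum>a<ds k. imb k a a)"
proof -
  have "frob_sq t (Suc k) = (\<Sum>a<ds k. cogram t (Suc k) a a)"
    using assms by (simp add: frob_sq_gt_one cogram_def power2_eq_square sum.swap[of _ "{..<ds k}"])
  also have "\<dots> = (\<Sum>a<ds k. gram t k a a + imb k a a)"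
    using assms by (simp add: cogram_eq)
  finally show ?thesis by (simp add: frob_sq_def sum.distrib)
qed

text \<open>Traces of the conserved differences are constant, so the squared norms of all layers
  differ by constants and grow together.\<close>

lemma frob_sq_bound:
  assumes "1 \<le> k" "k \<le> L"
  shows "\<exists>c. \<forall>t\<ge>0. frob_sq t k = frob_sq t L + c"
  using assms(2,1)
proof (induction k rule: inc_induct)
  case base
  show ?case by (intro exI[of _ 0]) simp
next
  case (step k)
  then obtain c where "\<forall>t\<ge>0. frob_sq t (Suc k) = frob_sq t L + c" by auto
  then show ?case using frob_sq_Suc[of _ k] step by (intro exI[of _ "c - (\<Sum>a<ds k. imb k a a)"]) auto
qed

text \<open>The residual of \<open>W\<^sub>k W\<^sub>k\<^sup>T\<close> having \<open>p t k\<close> as an eigenvector for the eigenvalue \<open>\<parallel>W\<^sub>L\<parallel>\<^sup>2\<close>;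
  it vanishes for \<open>k = L\<close> and is propagated downwards by balancedness.\<close>
definition "res t k a = (\<Sum>b<ds k. gram t k a b * p t k b) - frob_sq t L * p t k a"
definition "res_sq t k = (\<Sum>a<ds k. (res t k a)\<^sup>2)"

lemma res_top: "a < ds L \<Longrightarrow> res t L a = 0"
  by (simp add: res_def ds_top bprod_top frob_sq_def)

text \<open>Applying W_{k+1}^T to the eigenvector relation of layer \<open>k + 1\<close> gives one
  for \<open>cogram t (Suc k)\<close>, since W_{k+1}^T maps p_{k+1} to p_k; replacing
  \<open>cogram\<close> by \<open>gram\<close> costs the constant matrix
  \<open>imb k\<close>.\<close>

lemma res_step:
  assumes "0 \<le> t" "1 \<le> k" "k < L" "a < ds k"
  shows "res t k a = (\<Sum>i<ds (Suc k). res t (Suc k) i * W t (Suc k) i a) - (\<Sum>b<ds k. p t k b * imb k b a)"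
proof -
  let ?k = "Suc k"
  have sym: "imb k b a = imb k a b" for b
    by (simp add: imb_def cogram_def gram_def mult.commute inner_commute)
  have "(\<Sum>b<ds k. cogram t ?k a b * p t k b) = (\<Sum>b<ds k. \<Sum>i<ds ?k. (W t ?k i a * W t ?k i b) * p t k b)"
    by (simp add: cogram_def sum_distrib_right)
  also have "\<dots> = (\<Sum>i<ds ?k. W t ?k i a * (\<Sum>b<ds k. W t ?k i b * p t k b))"
    by (subst sum.swap) (simp add: sum_distrib_left mult_ac)
  also have "\<dots> = (\<Sum>i<ds ?k. W t ?k i a * (\<Sum>i'<ds ?k. gram t ?k i i' * p t ?k i'))"
  proof (rule sum.cong[OF refl], rule arg_cong2[where f = "(*)", OF refl])
    fix i
    have "(\<Sum>b<ds k. W t ?k i b * p t k b) = (\<Sum>b<ds k. \<Sum>i'<ds ?k. W t ?k i b * (p t ?k i' * W t ?k i' b))"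
      by (simp add: bprod_step[OF assms(3)] sum_distrib_left)
    also have "\<dots> = (\<Sum>i'<ds ?k. \<Sum>b<ds k. W t ?k i b * (p t ?k i' * W t ?k i' b))"
      by (rule sum.swap)
    finally show "(\<Sum>b<ds k. W t ?k i b * p t k b) = (\<Sum>i'<ds ?k. gram t ?k i i' * p t ?k i')"
      using assms by (simp add: gram_def sum_distrib_right sum_distrib_left mult_ac)
  qed
  also have "\<dots> = (\<Sum>i<ds ?k. W t ?k i a * (res t ?k i + frob_sq t L * p t ?k i))"
    by (simp add: res_def)
  also have "\<dots> = (\<Sum>i<ds ?k. res t ?k i * W t ?k i a) + frob_sq t L * p t k a"
    by (simp add: bprod_step[OF assms(3)] sum_distrib_left sum.distrib algebra_simps)
  finally have *: "(\<Sum>b<ds k. cogram t ?k a b * p t k b) = \<dots>" .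
  have "(\<Sum>b<ds k. cogram t ?k a b * p t k b) = (\<Sum>b<ds k. gram t k a b * p t k b) + (\<Sum>b<ds k. p t k b * imb k b a)"
    using assms by (simp add: cogram_eq sym sum.distrib algebra_simps)
  then show ?thesis using * by (simp add: res_def)
qed

lemma res_sq_step:
  assumes "0 \<le> t" "1 \<le> k" "k < L"
  shows "res_sq t k \<le> 2 * (res_sq t (Suc k) * frob_sq t (Suc k)) + 2 * (p_sq t k * (\<Sum>b<ds k. \<Sum>a<ds k. (imb k b a)\<^sup>2))"
proof -
  have sq: "(x - y)\<^sup>2 \<le> 2 * x\<^sup>2 + 2 * y\<^sup>2" for x y :: real
    using sum_squares_bound[of x "-y"] by (simp add: power2_diff)
  have "res_sq t k \<le> (\<Sum>a<ds k. 2 * (\<Sum>i<ds (Suc k). res t (Suc k) i * W t (Suc k) i a)\<^sup>2 + 2 * (\<Sum>b<ds k. p t k b * imb k b a)\<^sup>2)"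
    unfolding res_sq_def by (intro sum_mono) (simp add: res_step[OF assms] sq)
  also have "\<dots> = 2 * (\<Sum>a<ds k. (\<Sum>i<ds (Suc k). res t (Suc k) i * W t (Suc k) i a)\<^sup>2) + 2 * (\<Sum>a<ds k. (\<Sum>b<ds k. p t k b * imb k b a)\<^sup>2)"
    by (simp add: sum.distrib sum_distrib_left)
  also have "\<dots> \<le> 2 * (res_sq t (Suc k) * frob_sq t (Suc k)) + 2 * (p_sq t k * (\<Sum>b<ds k. \<Sum>a<ds k. (imb k b a)\<^sup>2))"
    using assms by (intro add_mono mult_left_mono order_trans[OF sum_square_mult_le]) (auto simp: res_sq_def p_sq_def frob_sq_gt_one)
  finally show ?thesis .
qed

text \<open>The squared norm of p_k is the quadratic form of \<open>gram t (Suc k)\<close> at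
  p_{k+1}, to which the approximate eigenvector relation applies; \<open>w_sq\<close> does the same
  with W_1.\<close>

lemma p_sq_step:
  assumes "1 \<le> k" "k < L"
  shows "p_sq t k = frob_sq t L * p_sq t (Suc k) + (\<Sum>i<ds (Suc k). p t (Suc k) i * res t (Suc k) i)"
proof -
  have "p_sq t k = (\<Sum>i<ds (Suc k). p t (Suc k) i * (\<Sum>i'<ds (Suc k). gram t (Suc k) i i' * p t (Suc k) i'))"
    using assms unfolding p_sq_def bprod_step[OF assms(2)] sum_square_mult by (simp add: gram_def)
  also have "\<dots> = (\<Sum>i<ds (Suc k). p t (Suc k) i * (res t (Suc k) i + frob_sq t L * p t (Suc k) i))"
    by (simp add: res_def)
  finally show ?thesis by (simp add: p_sq_def sum.distrib sum_distrib_left power2_eq_square algebra_simps)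
qed

lemma w_sq: "(norm (w t))\<^sup>2 = frob_sq t L * p_sq t 1 + (\<Sum>i<ds 1. p t 1 i * res t 1 i)"
proof -
  have "(norm (w t))\<^sup>2 = (\<Sum>i<ds 1. p t 1 i * (\<Sum>i'<ds 1. gram t 1 i i' * p t 1 i'))"
    using L_ge by (simp add: wprod_one ds_top norm_sum_scaleR_square gram_def)
  also have "\<dots> = (\<Sum>i<ds 1. p t 1 i * (res t 1 i + frob_sq t L * p t 1 i))"
    by (simp add: res_def)
  finally show ?thesis by (simp add: p_sq_def sum.distrib sum_distrib_left power2_eq_square algebra_simps)
qed

lemma p_res_le: "\<bar>\<Sum>i<ds k. p t k i * res t k i\<bar> \<le> p_sq t k + res_sq t k"
proof -
  have "\<bar>\<Sum>i<ds k. p t k i * res t k i\<bar> \<le> (\<Sum>i<ds k. \<bar>p t k i * res t k i\<bar>)" by (rule sum_abs)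
  also have "\<dots> \<le> (\<Sum>i<ds k. (p t k i)\<^sup>2 + (res t k i)\<^sup>2)"
  proof (intro sum_mono)
    fix i
    have "2 * \<bar>p t k i\<bar> * \<bar>res t k i\<bar> \<le> \<bar>p t k i\<bar>\<^sup>2 + \<bar>res t k i\<bar>\<^sup>2" by (rule sum_squares_bound)
    moreover have "0 \<le> \<bar>p t k i\<bar> * \<bar>res t k i\<bar>" by simp
    ultimately show "\<bar>p t k i * res t k i\<bar> \<le> (p t k i)\<^sup>2 + (res t k i)\<^sup>2" unfolding abs_mult power2_abs by linarith
  qed
  finally show ?thesis by (simp add: p_sq_def res_sq_def sum.distrib)
qed

text \<open>With x = \<open>frob_sq t L\<close>, one step down multiplies |p|^2 by x up to an error
  of the order of |p|^2, a relative error O(1/x), while the residual stays of order x^(L-k). The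
  error bound is multiplied by x so that it is meaningful for exponent 0 as well.\<close>

lemma p_sq_approx:
  assumes "1 \<le> k" "k \<le> L"
  shows "\<exists>C\<ge>0. \<forall>t\<ge>0. frob_sq t L \<ge> 1 \<longrightarrow>
    \<bar>p_sq t k - frob_sq t L ^ (L - k)\<bar> * frob_sq t L \<le> C * frob_sq t L ^ (L - k) \<and>
    p_sq t k \<le> C * frob_sq t L ^ (L - k) \<and> res_sq t k \<le> C * frob_sq t L ^ (L - k)"
  using assms(2,1)
proof (induction k rule: inc_induct)
  case base
  have "p_sq t L = 1" "res_sq t L = 0" for t
    by (auto simp: p_sq_def res_sq_def res_top) (simp add: ds_top bprod_top)
  then show ?case by (intro exI[of _ 1]) auto
next
  case (step k)
  then obtain C where C: "C \<ge> 0" and IH: "\<And>t. t \<ge> 0 \<Longrightarrow> frob_sq t L \<ge> 1 \<Longrightarrow>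
    \<bar>p_sq t (Suc k) - frob_sq t L ^ (L - Suc k)\<bar> * frob_sq t L \<le> C * frob_sq t L ^ (L - Suc k) \<and>
    p_sq t (Suc k) \<le> C * frob_sq t L ^ (L - Suc k) \<and> res_sq t (Suc k) \<le> C * frob_sq t L ^ (L - Suc k)"
    by auto
  obtain c where c: "\<And>t. t \<ge> 0 \<Longrightarrow> frob_sq t (Suc k) = frob_sq t L + c"
    using frob_sq_bound[of "Suc k"] step by auto
  define B where "B = (\<Sum>b<ds k. \<Sum>a<ds k. (imb k b a)\<^sup>2)"
  have B: "B \<ge> 0" unfolding B_def by (intro sum_nonneg) auto
  obtain m where m: "L - k = Suc m" "L - Suc k = m" using step.hyps by (cases "L - k") auto
  \<comment> \<open>The 3 collects the error inherited from layer \<open>k + 1\<close> and the two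
    terms of \<open>p_res_le\<close>; the 1 is the main term x^(L-k).\<close>
  define C1 where "C1 = 1 + 3 * C"
  \<comment> \<open>The two summands come from \<open>res_sq_step\<close>;
    \<open>1 + \<bar>c\<bar>\<close> bounds the ratio of \<open>frob_sq t (Suc k)\<close> to x, as x
    is at least 1.\<close>
  define C2 where "C2 = 2 * (C * (1 + \<bar>c\<bar>)) + 2 * (C1 * B)"
  show ?case
  proof (intro exI[of _ "C1 + C2"] conjI allI impI)
    show nn: "0 \<le> C1 + C2" using C B by (simp add: C1_def C2_def)
    have C1: "C1 \<ge> 0" and C2: "C2 \<ge> 0" using C B by (simp_all add: C1_def C2_def)
    fix t :: real assume t: "t \<ge> 0" and x: "frob_sq t L \<ge> 1"
    define x where "x = frob_sq t L"
    have x1: "x \<ge> 1" using x by (simp add: x_def)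
    define r where "r = (\<Sum>i<ds (Suc k). p t (Suc k) i * res t (Suc k) i)"
    note IH' = IH[OF t x, folded x_def, unfolded m]
    have r: "\<bar>r\<bar> \<le> 2 * C * x ^ m"
      using p_res_le[where t = t and k = "Suc k"] IH' unfolding r_def by linarith
    have eq: "p_sq t k = x * p_sq t (Suc k) + r"
      using p_sq_step[of k t] step by (simp add: x_def r_def)
    have "\<bar>p_sq t k - x ^ Suc m\<bar> = \<bar>(p_sq t (Suc k) - x ^ m) * x + r\<bar>"
      unfolding eq by (simp add: algebra_simps)
    also have "\<dots> \<le> \<bar>p_sq t (Suc k) - x ^ m\<bar> * x + \<bar>r\<bar>"
      using x1 by (intro order_trans[OF abs_triangle_ineq]) (simp add: abs_mult)
    also have "\<dots> \<le> 3 * C * x ^ m" using r IH' by linarith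
    finally have d: "\<bar>p_sq t k - x ^ Suc m\<bar> \<le> 3 * C * x ^ m" .
    have xm: "0 \<le> x ^ m" "x ^ m \<le> x ^ Suc m" "0 \<le> x ^ Suc m" using x1 by auto
    have "\<bar>p_sq t k - x ^ Suc m\<bar> * x \<le> 3 * C * x ^ Suc m"
      using mult_right_mono[OF d, of x] x1 by (simp add: mult_ac)
    also have "\<dots> \<le> (C1 + C2) * x ^ Suc m"
      using C C2 xm by (intro mult_right_mono) (auto simp: C1_def)
    finally show "\<bar>p_sq t k - frob_sq t L ^ (L - k)\<bar> * frob_sq t L \<le> (C1 + C2) * frob_sq t L ^ (L - k)"
      unfolding m x_def .
    have "p_sq t k \<le> x ^ Suc m + 3 * C * x ^ m" using d by linarith
    also have "\<dots> \<le> x ^ Suc m + 3 * C * x ^ Suc m" using xm C by (intro add_left_mono mult_left_mono) auto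
    finally have pk: "p_sq t k \<le> C1 * x ^ Suc m" by (simp add: C1_def algebra_simps)
    also have "\<dots> \<le> (C1 + C2) * x ^ Suc m" using C2 xm by (intro mult_right_mono) auto
    finally show "p_sq t k \<le> (C1 + C2) * frob_sq t L ^ (L - k)" unfolding m x_def .
    have F: "frob_sq t (Suc k) \<le> (1 + \<bar>c\<bar>) * x"
    proof -
      have "\<bar>c\<bar> * 1 \<le> \<bar>c\<bar> * x" using x1 by (intro mult_left_mono) auto
      then show ?thesis using c[OF t] by (simp add: x_def algebra_simps)
    qed
    have "res_sq t k \<le> 2 * (res_sq t (Suc k) * frob_sq t (Suc k)) + 2 * (p_sq t k * B)"
      using res_sq_step[OF t, of k] step by (simp add: B_def)
    also have "\<dots> \<le> 2 * ((C * x ^ m) * ((1 + \<bar>c\<bar>) * x)) + 2 * ((C1 * x ^ Suc m) * B)"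
      using IH' F pk B C x1 frob_sq_nonneg[of t "Suc k"]
      by (intro add_mono mult_left_mono mult_mono mult_right_mono) auto
    also have "\<dots> = C2 * x ^ Suc m" by (simp add: C2_def algebra_simps)
    also have "\<dots> \<le> (C1 + C2) * x ^ Suc m" using C1 xm by (intro mult_right_mono) auto
    finally show "res_sq t k \<le> (C1 + C2) * frob_sq t L ^ (L - k)" unfolding m x_def .
  qed
qed

lemma w_sq_approx:
  "\<exists>C\<ge>0. \<forall>t\<ge>0. frob_sq t L \<ge> 1 \<longrightarrow> \<bar>(norm (w t))\<^sup>2 - frob_sq t L ^ L\<bar> \<le> C * frob_sq t L ^ (L - 1)"
proof -
  obtain C where C: "C \<ge> 0" and IH: "\<And>t. t \<ge> 0 \<Longrightarrow> frob_sq t L \<ge> 1 \<Longrightarrow>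
    \<bar>p_sq t 1 - frob_sq t L ^ (L - 1)\<bar> * frob_sq t L \<le> C * frob_sq t L ^ (L - 1) \<and>
    p_sq t 1 \<le> C * frob_sq t L ^ (L - 1) \<and> res_sq t 1 \<le> C * frob_sq t L ^ (L - 1)"
    using p_sq_approx[of 1] L_ge by auto
  have "\<bar>(norm (w t))\<^sup>2 - frob_sq t L ^ L\<bar> \<le> 3 * C * frob_sq t L ^ (L - 1)" if t: "t \<ge> 0" "frob_sq t L \<ge> 1" for t
  proof -
    define x where "x = frob_sq t L"
    have x1: "x \<ge> 1" using that by (simp add: x_def)
    obtain m where m: "L = Suc m" using L_ge by (cases L) auto
    define r where "r = (\<Sum>i<ds 1. p t 1 i * res t 1 i)"
    note IH' = IH[OF t, folded x_def]
    have "\<bar>(norm (w t))\<^sup>2 - x ^ L\<bar> = \<bar>(p_sq t 1 - x ^ (L - 1)) * x + r\<bar>"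
      unfolding w_sq r_def[symmetric] x_def[symmetric] by (simp add: m algebra_simps)
    also have "\<dots> \<le> \<bar>p_sq t 1 - x ^ (L - 1)\<bar> * x + \<bar>r\<bar>"
      using x1 by (intro order_trans[OF abs_triangle_ineq]) (simp add: abs_mult)
    also have "\<dots> \<le> 3 * C * x ^ (L - 1)" using p_res_le[where t = t and k = 1] IH' unfolding r_def by linarith
    finally show ?thesis unfolding x_def .
  qed
  then show ?thesis using C by (intro exI[of _ "3 * C"]) auto
qed

text \<open>Once x is at least twice the constant of \<open>p_sq_approx\<close>, the relative error
  is at most one half, and x^(L-1) is at least 1.\<close>

lemma p_sq_lower:
  "\<exists>S. \<forall>t\<ge>0. frob_sq t L \<ge> S \<longrightarrow> p_sq t 1 \<ge> 1 / 2"
proof -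
  obtain C where C: "C \<ge> 0" and IH: "\<And>t. t \<ge> 0 \<Longrightarrow> frob_sq t L \<ge> 1 \<Longrightarrow>
    \<bar>p_sq t 1 - frob_sq t L ^ (L - 1)\<bar> * frob_sq t L \<le> C * frob_sq t L ^ (L - 1)"
    using p_sq_approx[of 1] L_ge by auto
  have "p_sq t 1 \<ge> 1 / 2" if t: "t \<ge> 0" and S: "frob_sq t L \<ge> max 1 (2 * C)" for t
  proof -
    define x where "x = frob_sq t L"
    define y where "y = x ^ (L - 1)"
    have x: "x \<ge> 1" "x \<ge> 2 * C" using S by (simp_all add: x_def)
    have y: "y \<ge> 1" using x by (simp add: y_def)
    have "\<bar>p_sq t 1 - y\<bar> * x \<le> C * y" using IH[OF t] x unfolding x_def y_def by simp
    also have "\<dots> \<le> (y / 2) * x" using mult_right_mono[OF x(2), of y] y by simp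
    finally have "\<bar>p_sq t 1 - y\<bar> \<le> y / 2" using x by simp
    then show ?thesis using y by linarith
  qed
  then show ?thesis by blast
qed

section \<open>Comparison of the product vector with the product of the layer norms\<close>

lemma w_sq_le: "(norm (w t))\<^sup>2 \<le> p_sq t 1 * frob_sq t 1"
  using norm_sum_scaleR_square_le[of "p t 1" "W1 t" "ds 1"] L_ge
  by (simp add: wprod_one ds_top p_sq_def frob_sq_one[simplified])

text \<open>Submultiplicativity of the Frobenius norm, valid at all times without an error
  term.\<close>

lemma p_sq_le_prod:
  assumes "1 \<le> k" "k \<le> L"
  shows "p_sq t k \<le> (\<Prod>l\<in>{Suc k..L}. frob_sq t l)"
  using assms(2,1)
proof (induction k rule: inc_induct)
  case base
  then show ?case by (simp add: p_sq_def ds_top bprod_top)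
next
  case (step k)
  have "p_sq t k \<le> p_sq t (Suc k) * frob_sq t (Suc k)"
    unfolding p_sq_def bprod_step[OF step.hyps(2)] using sum_square_mult_le step.prems by (simp add: frob_sq_gt_one)
  also have "\<dots> \<le> (\<Prod>l\<in>{Suc (Suc k)..L}. frob_sq t l) * frob_sq t (Suc k)"
    using step frob_sq_nonneg by (intro mult_right_mono) auto
  also have "\<dots> = (\<Prod>l\<in>{Suc k..L}. frob_sq t l)"
    using step.hyps by (simp add: prod.atLeast_Suc_atMost[of "Suc k"] mult.commute)
  finally show ?case .
qed

lemma frob_sq_ratio:
  assumes "filterlim (\<lambda>t. frob_sq t L) at_top at_top" "1 \<le> k" "k \<le> L"
  shows "((\<lambda>t. frob_sq t k / frob_sq t L) \<longlongrightarrow> 1) at_top"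
proof -
  obtain c where c: "\<And>t. t \<ge> 0 \<Longrightarrow> frob_sq t k = frob_sq t L + c"
    using frob_sq_bound[OF assms(2,3)] by auto
  have "((\<lambda>t. 1 + c / frob_sq t L) \<longlongrightarrow> 1 + 0) at_top"
    by (intro tendsto_intros tendsto_divide_0[OF tendsto_const] filterlim_at_top_imp_at_infinity assms(1))
  moreover have "eventually (\<lambda>t. 1 + c / frob_sq t L = frob_sq t k / frob_sq t L) at_top"
    using eventually_ge_at_top[of 0] filterlim_at_top_dense[THEN iffD1, OF assms(1), THEN spec, of 0]
    by eventually_elim (simp add: c field_simps)
  ultimately show ?thesis by (simp add: Lim_transform_eventually)
qed

text \<open>Numerator and denominator are both asymptotic to x^L for x = \<open>frob_sq t L\<close>:
  the former by \<open>w_sq_approx\<close>, the latter because the squared layer norms differ by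
  constants.\<close>

lemma norm_w_ratio:
  assumes x: "filterlim (\<lambda>t. frob_sq t L) at_top at_top"
  shows "((\<lambda>t. (norm (w t))\<^sup>2 / (\<Prod>k\<in>{1..L}. frob_sq t k)) \<longlongrightarrow> 1) at_top"
proof -
  obtain C where C: "C \<ge> 0" and w: "\<And>t. t \<ge> 0 \<Longrightarrow> frob_sq t L \<ge> 1 \<Longrightarrow>
    \<bar>(norm (w t))\<^sup>2 - frob_sq t L ^ L\<bar> \<le> C * frob_sq t L ^ (L - 1)"
    using w_sq_approx by auto
  have ev: "eventually (\<lambda>t. t \<ge> 0 \<and> frob_sq t L \<ge> 1) at_top"
    using eventually_ge_at_top[of 0] filterlim_at_top[THEN iffD1, OF x, THEN spec, of 1] by eventually_elim simp
  have "((\<lambda>t. (norm (w t))\<^sup>2 / frob_sq t L ^ L - 1) \<longlongrightarrow> 0) at_top"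
  proof (rule Lim_null_comparison)
    show "((\<lambda>t. C / frob_sq t L) \<longlongrightarrow> 0) at_top"
      by (intro tendsto_divide_0[OF tendsto_const] filterlim_at_top_imp_at_infinity x)
    show "eventually (\<lambda>t. norm ((norm (w t))\<^sup>2 / frob_sq t L ^ L - 1) \<le> C / frob_sq t L) at_top"
      using ev
    proof eventually_elim
      case (elim t)
      define x where "x = frob_sq t L"
      have x: "x \<ge> 1" using elim by (simp add: x_def)
      obtain m where m: "L = Suc m" using L_ge by (cases L) auto
      have "norm ((norm (w t))\<^sup>2 / x ^ L - 1) = \<bar>(norm (w t))\<^sup>2 - x ^ L\<bar> / x ^ L"
        using x by (simp add: field_simps)
      also have "\<dots> \<le> C * x ^ (L - 1) / x ^ L"
        using w[of t] elim x unfolding x_def by (intro divide_right_mono) auto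
      also have "\<dots> = C / x" using x by (simp add: m)
      finally show ?case unfolding x_def .
    qed
  qed
  then have 1: "((\<lambda>t. (norm (w t))\<^sup>2 / frob_sq t L ^ L) \<longlongrightarrow> 1) at_top"
    by (simp add: LIM_zero_iff)
  have 2: "((\<lambda>t. \<Prod>k\<in>{1..L}. frob_sq t k / frob_sq t L) \<longlongrightarrow> (\<Prod>k\<in>{1..L}. 1)) at_top"
    by (intro tendsto_prod frob_sq_ratio x) auto
  have "((\<lambda>t. ((norm (w t))\<^sup>2 / frob_sq t L ^ L) / (\<Prod>k\<in>{1..L}. frob_sq t k / frob_sq t L)) \<longlongrightarrow> 1 / (\<Prod>k\<in>{1..L}. 1)) at_top"
    by (intro tendsto_divide 1 2) auto
  moreover have "eventually (\<lambda>t. ((norm (w t))\<^sup>2 / frob_sq t L ^ L) / (\<Prod>k\<in>{1..L}. frob_sq t k / frob_sq t L)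
     = (norm (w t))\<^sup>2 / (\<Prod>k\<in>{1..L}. frob_sq t k)) at_top"
    using ev by eventually_elim (auto simp: prod_dividef)
  ultimately show ?thesis by (simp add: Lim_transform_eventually)
qed

end

section \<open>Convergence to the maximum margin direction\<close>

declare One_nat_def [simp del]

section \<open>Mean value arguments on the half line\<close>

lemma mvt_halfline:
  fixes f :: "real \<Rightarrow> real"
  assumes "\<And>t. 0 \<le> t \<Longrightarrow> (f has_real_derivative f' t) (at t within {0..})" "0 \<le> a" "a < b"
  shows "\<exists>x\<in>{a<..<b}. f b - f a = f' x * (b - a)"
proof -
  have "(f has_derivative (*) (f' x)) (at x within {a..b})" if "a \<le> x" "x \<le> b" for x
    using assms(1)[of x] that assms(2) unfolding has_field_derivative_def
    by (auto intro: has_derivative_subset)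
  from mvt_simple[OF assms(3) this] show ?thesis .
qed

text \<open>Above the level \<open>e * F\<close> the function \<open>H\<close> does not grow, whereas \<open>F\<close> does; so \<open>H\<close> has to
  fall below that level and can never return.\<close>
lemma ratio_tendsto_0_of_derivs:
  fixes F H :: "real \<Rightarrow> real"
  assumes F: "\<And>t. 0 \<le> t \<Longrightarrow> (F has_real_derivative F' t) (at t within {0..})"
    and H: "\<And>t. 0 \<le> t \<Longrightarrow> (H has_real_derivative H' t) (at t within {0..})"
    and H0: "\<And>t. 0 \<le> t \<Longrightarrow> 0 \<le> H t"
    and Flim: "filterlim F at_top at_top"
    and F': "eventually (\<lambda>t. 0 \<le> F' t) at_top"
    and H': "\<And>e. 0 < e \<Longrightarrow> eventually (\<lambda>t. e * F t \<le> H t \<longrightarrow> H' t \<le> 0) at_top"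
  shows "((\<lambda>t. H t / F t) \<longlongrightarrow> 0) at_top"
proof (rule tendstoI)
  fix e' :: real assume "0 < e'"
  define e where "e = e' / 2"
  have e: "0 < e" "e < e'" using \<open>0 < e'\<close> by (auto simp: e_def)
  have "eventually (\<lambda>t. 0 \<le> t \<and> 0 < F t \<and> 0 \<le> F' t \<and> (e * F t \<le> H t \<longrightarrow> H' t \<le> 0)) at_top"
    using F' H'[OF e(1)] eventually_ge_at_top[of 0] filterlim_at_top_dense[THEN iffD1, OF Flim, THEN spec, of 0]
    by eventually_elim auto
  then obtain T where T: "\<And>t. T \<le> t \<Longrightarrow> 0 \<le> t \<and> 0 < F t \<and> 0 \<le> F' t \<and> (e * F t \<le> H t \<longrightarrow> H' t \<le> 0)"
    unfolding eventually_at_top_linorder by blast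
  \<comment> \<open>Otherwise \<open>H\<close> would never exceed \<open>H T\<close> after time
    \<open>T\<close>, while \<open>e * F\<close> is unbounded.\<close>
  obtain t1 where t1: "T \<le> t1" "H t1 < e * F t1"
  proof (rule ccontr)
    assume "\<not> thesis"
    with that have ge: "\<And>t. T \<le> t \<Longrightarrow> e * F t \<le> H t" by force
    have le: "H t \<le> H T" if "T \<le> t" for t
    proof (cases "T = t")
      case False
      then have "T < t" using that by simp
      then obtain x where x: "x \<in> {T<..<t}" "H t - H T = H' x * (t - T)"
        using mvt_halfline[where f = H and f' = H', OF H, of T t] T[of T] that by auto
      moreover have "H' x * (t - T) \<le> 0" using T[of x] ge[of x] x by (intro mult_nonpos_nonneg) auto
      ultimately show ?thesis by simp
    qed simp
    obtain t where "T \<le> t" "H T / e + 1 \<le> F t"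
      using eventually_happens'[OF trivial_limit_at_top_linorder
        eventually_conj[OF filterlim_at_top[THEN iffD1, OF Flim, THEN spec, of "H T / e + 1"] eventually_ge_at_top[of T]]]
      by blast
    then show False using ge[of t] le[of t] e by (auto simp: field_simps)
  qed
  have "H t2 \<le> e * F t2" if "t1 \<le> t2" for t2
  proof (rule ccontr)
    define f where "f t = H t - e * F t" for t
    assume "\<not> H t2 \<le> e * F t2"
    then have f2: "f t2 > 0" by (simp add: f_def)
    have fd: "(f has_real_derivative H' t - e * F' t) (at t within {0..})" if "0 \<le> t" for t
      unfolding f_def by (intro DERIV_diff DERIV_cmult F H that)
    have "continuous_on {0..} f"
      by (rule DERIV_continuous_on, rule fd) simp
    then have "continuous_on {t1..t2} f"
      by (rule continuous_on_subset) (use T t1 in force)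
    then have "closed {t \<in> {t1..t2}. f t \<le> 0}"
      by (intro continuous_on_closed_Collect_le) auto
    then have "compact {t \<in> {t1..t2}. f t \<le> 0}"
      unfolding compact_eq_bounded_closed by (auto intro: bounded_subset[of "{t1..t2}"])
    moreover have "t1 \<in> {t \<in> {t1..t2}. f t \<le> 0}" using t1 that by (simp add: f_def)
    \<comment> \<open>\<open>s\<close> is the last time in the interval at which \<open>f\<close> is
      not positive; afterwards \<open>f\<close> is positive, so it cannot increase, which
      contradicts \<open>f t2 > 0\<close>.\<close>
    ultimately obtain s where s: "s \<in> {t1..t2}" "f s \<le> 0" "\<And>t. t \<in> {t1..t2} \<Longrightarrow> f t \<le> 0 \<Longrightarrow> t \<le> s"
      using compact_attains_sup[of "{t \<in> {t1..t2}. f t \<le> 0}"] by auto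
    have "s < t2" using s f2 by (cases "s = t2") auto
    moreover have "0 \<le> s" using s T[of s] t1 by auto
    ultimately obtain x where x: "x \<in> {s<..<t2}" "f t2 - f s = (H' x - e * F' x) * (t2 - s)"
      using mvt_halfline[OF fd, of s t2] by auto
    have "f x > 0" using s(3)[of x] x s(1) by force
    then have "H' x - e * F' x \<le> 0" using T[of x] x s t1 e by (auto simp: f_def) (smt (verit) mult_nonneg_nonneg)
    then have "(H' x - e * F' x) * (t2 - s) \<le> 0" using \<open>s < t2\<close> by (intro mult_nonpos_nonneg) auto
    then show False using x f2 s(2) by linarith
  qed
  then have "eventually (\<lambda>t. H t \<le> e * F t) at_top"
    by (auto simp: eventually_at_top_linorder)
  then show "eventually (\<lambda>t. dist (H t / F t) 0 < e') at_top"
    using eventually_ge_at_top[of T]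
  proof eventually_elim
    case (elim t)
    then have "0 < F t" "0 \<le> H t" using T[of t] H0[of t] by auto
    then have "H t / F t \<le> e" "0 \<le> H t / F t" using elim by (auto simp: field_simps)
    then show ?case using e by simp
  qed
qed

text \<open>The conditions on \<open>c\<close> are what the exponential and the logistic loss share,
  notably a two-sided comparison with \<open>exp (- x)\<close> for nonnegative x.
  \<open>opposed\<close> is the genericity of the data in quantitative form, and
  \<open>init_grad\<close> says that the risk initially decreases at a positive rate.\<close>

locale separable_deep_linear_flow = deep_linear_flow L ds W1 W g
  for L ds W1 W and g :: "real \<Rightarrow> real^'d" +
  fixes loss c :: "real \<Rightarrow> real" and Z :: "'n::finite \<Rightarrow> real^'d" and u :: "real^'d" and \<gamma> \<epsilon> :: real
  assumes g_eq: "g t = drisk c Z (wprod ds L (W1 t) (W t))"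
    and loss_deriv: "(loss has_real_derivative - c x) (at x)"
    and c_pos: "0 < c x"
    and c_antimono: "x \<le> x' \<Longrightarrow> c x' \<le> c x"
    and c_le: "0 \<le> x \<Longrightarrow> c x \<le> exp (- x)"
    and c_ge: "0 \<le> x \<Longrightarrow> exp (- x) / 2 \<le> c x"
    and loss_pos: "0 < loss x"
    and loss_lim: "(loss \<longlongrightarrow> 0) at_top"
    and norm_u: "norm u = 1" and \<gamma>_pos: "0 < \<gamma>" and margin: "\<gamma> \<le> inner u (Z i)"
    and \<epsilon>_pos: "0 < \<epsilon>"
    and opposed: "inner \<xi> u = 0 \<Longrightarrow> \<exists>i. inner u (Z i) = \<gamma> \<and> inner \<xi> (Z i) \<le> - \<epsilon> * norm \<xi>"
    and init_risk: "(1 / real CARD('n)) * (\<Sum>i\<in>UNIV. loss (inner (wprod ds L (W1 0) (W 0)) (Z i))) \<le> loss 0"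
    and init_grad: "0 < p_sq 0 1 * (norm (g 0))\<^sup>2
       + (\<Sum>k\<in>{2..L}. p_sq 0 k * (\<Sum>j<ds (k - 1). (inner (fprod ds (W1 0) (W 0) (k - 1) j) (g 0))\<^sup>2))"
begin

definition "mean_loss v = (1 / real CARD('n)) * (\<Sum>i\<in>UNIV. loss (inner v (Z i)))"
text \<open>The dissipation rate: \<open>mean_loss_deriv\<close> identifies it as minus the time
  derivative of the risk.\<close>

definition "rate t = p_sq t 1 * (norm (g t))\<^sup>2
   + (\<Sum>k\<in>{2..L}. p_sq t k * (\<Sum>j<ds (k - 1). (inner (q t (k - 1) j) (g t))\<^sup>2))"

section \<open>Convergence of the risk to zero\<close>

lemma rate_ge: "p_sq t 1 * (norm (g t))\<^sup>2 \<le> rate t"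
  unfolding rate_def using p_sq_nonneg by (simp add: sum_nonneg)

lemma rate_nonneg: "0 \<le> rate t"
  by (rule order_trans[OF _ rate_ge]) (simp add: p_sq_nonneg)

lemma loss_less_iff: "loss x < loss y \<longleftrightarrow> y < x"
proof -
  have *: "loss b < loss a" if "a < b" for a b
    by (rule DERIV_neg_imp_decreasing[OF that]) (use loss_deriv c_pos in \<open>force\<close>)
  show ?thesis using *[of x y] *[of y x] by (cases x y rule: linorder_cases) auto
qed

lemma mean_loss_deriv:
  assumes "0 \<le> t"
  shows "((\<lambda>s. mean_loss (w s)) has_real_derivative - rate t) (at t within {0..})"
proof -
  obtain w' where w': "(w has_vector_derivative w') (at t within {0..})" and e: "inner w' (g t) = - (p_sq t 1 * (norm (g t))\<^sup>2)
       - (\<Sum>k\<in>{2..L}. p_sq t k * (\<Sum>j<ds (k - 1). (inner (q t (k - 1) j) (g t))\<^sup>2))"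
    using w_deriv[OF assms] by blast
  show ?thesis
    using has_derivative_mean_loss[OF loss_deriv w', of Z] e by (simp add: mean_loss_def rate_def g_eq)
qed

lemma mean_loss_antimono:
  assumes "0 \<le> s" "s \<le> t"
  shows "mean_loss (w t) \<le> mean_loss (w s)"
proof (cases "s = t")
  case False
  then obtain x where "x \<in> {s<..<t}" "mean_loss (w t) - mean_loss (w s) = - rate x * (t - s)"
    using mvt_halfline[OF mean_loss_deriv, of s t] assms by force
  moreover have "0 \<le> rate x * (t - s)" using rate_nonneg assms by simp
  ultimately show ?thesis by simp
qed simp

lemma mean_loss_pos: "0 < mean_loss v"
  by (simp add: mean_loss_def loss_pos sum_pos)

text \<open>A positive initial rate brings the risk strictly below its value at the zero vector; by
  monotonicity it stays there, and by continuity this excludes a ball around zero.\<close>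

lemma w_away_from_0:
  obtains t\<^sub>1 \<delta> where "0 \<le> t\<^sub>1" "0 < \<delta>" "\<And>t. t\<^sub>1 \<le> t \<Longrightarrow> \<delta> \<le> norm (w t)"
proof -
  have "- rate 0 < 0" using init_grad by (simp add: rate_def)
  from has_real_derivative_neg_dec_right[OF mean_loss_deriv[of 0] this]
  obtain d where d: "0 < d" "\<And>h. 0 < h \<Longrightarrow> h < d \<Longrightarrow> mean_loss (w h) < mean_loss (w 0)" by auto
  define t1 where "t1 = d / 2"
  have less: "mean_loss (w t1) < mean_loss 0"
    using d(2)[of t1] d(1) init_risk by (simp add: t1_def mean_loss_def)
  have "isCont loss x" for x using loss_deriv DERIV_isCont by blast
  then have "isCont (\<lambda>v. loss (inner v (Z i))) 0" for i
    by (rule isCont_o2[where g = loss, rotated]) (intro continuous_intros)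
  then have "isCont mean_loss 0"
    unfolding mean_loss_def by (intro continuous_intros) auto
  then have "eventually (\<lambda>v. mean_loss (w t1) < mean_loss v) (nhds 0)"
    using less unfolding isCont_def by (metis order_tendstoD(1) tendsto_at_iff_tendsto_nhds)
  then obtain \<delta> where \<delta>: "0 < \<delta>" "\<And>v. norm v < \<delta> \<Longrightarrow> mean_loss (w t1) < mean_loss v"
    unfolding eventually_nhds_metric by auto
  have "\<delta> \<le> norm (w t)" if "t1 \<le> t" for t
    using mean_loss_antimono[of t1 t] \<delta>(2)[of "w t"] that d(1) by (force simp: t1_def)
  then show ?thesis using that[of t1 \<delta>] d \<delta> by (simp add: t1_def)
qed

lemma p_sq_away_from_0:
  obtains t\<^sub>1 \<kappa> where "0 \<le> t\<^sub>1" "0 < \<kappa>" "\<And>t. t\<^sub>1 \<le> t \<Longrightarrow> \<kappa> \<le> p_sq t 1"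
proof -
  obtain t1 \<delta> where t1: "0 \<le> t1" "0 < \<delta>" "\<And>t. t1 \<le> t \<Longrightarrow> \<delta> \<le> norm (w t)"
    using w_away_from_0 by blast
  obtain S where S: "\<And>t. 0 \<le> t \<Longrightarrow> S \<le> frob_sq t L \<Longrightarrow> 1 / 2 \<le> p_sq t 1"
    using p_sq_lower by blast
  obtain c1 where c1: "\<And>t. 0 \<le> t \<Longrightarrow> frob_sq t 1 = frob_sq t L + c1"
    using frob_sq_bound[of 1] L_ge by auto
  \<comment> \<open>\<open>B\<close> bounds \<open>frob_sq t 1\<close> as long as
    \<open>frob_sq t L\<close> is below \<open>S\<close>; the summand 1 keeps it positive.\<close>
  define B where "B = \<bar>S\<bar> + \<bar>c1\<bar> + 1"
  have B: "0 < B" by (simp add: B_def)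
  have "min (1 / 2) (\<delta>\<^sup>2 / B) \<le> p_sq t 1" if t: "t1 \<le> t" for t
  proof (cases "S \<le> frob_sq t L")
    case True
    then show ?thesis using S[of t] t t1 by simp
  next
    case False
    have "\<delta>\<^sup>2 \<le> (norm (w t))\<^sup>2" using t1 t by (intro power_mono) auto
    also have "\<dots> \<le> p_sq t 1 * frob_sq t 1" by (rule w_sq_le)
    also have "\<dots> \<le> p_sq t 1 * B"
      using False c1[of t] t t1 by (intro mult_left_mono p_sq_nonneg) (auto simp: B_def)
    finally show ?thesis using B by (simp add: field_simps min_le_iff_disj)
  qed
  then show ?thesis using that[of t1 "min (1 / 2) (\<delta>\<^sup>2 / B)"] t1 B by simp
qed

text \<open>Tested against \<open>u\<close>, all terms of minus the gradient are positive, so each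
  of them alone bounds the norm from below.\<close>

lemma norm_g_ge: "\<gamma> / real CARD('n) * c (inner (w t) (Z i)) \<le> norm (g t)"
proof -
  have "\<gamma> * c (inner (w t) (Z i)) \<le> (\<Sum>i\<in>UNIV. \<gamma> * c (inner (w t) (Z i)))"
    by (rule member_le_sum) (use \<gamma>_pos c_pos in \<open>auto intro: less_imp_le\<close>)
  also have "\<dots> \<le> (\<Sum>i\<in>UNIV. c (inner (w t) (Z i)) * inner u (Z i))"
    using margin c_pos by (intro sum_mono) (simp add: mult.commute less_imp_le mult_left_mono)
  also have "\<dots> = real CARD('n) * - inner u (g t)"
    by (simp add: g_eq inner_drisk)
  also have "\<dots> \<le> real CARD('n) * norm (g t)"
    using Cauchy_Schwarz_ineq2[of u "g t"] norm_u by (intro mult_left_mono) auto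
  finally show ?thesis by (simp add: field_simps)
qed

lemma mean_loss_eventually_less:
  assumes "0 < e"
  shows "eventually (\<lambda>t. mean_loss (w t) < e) at_top"
proof -
  obtain t1 \<kappa> where t1: "0 \<le> t1" "0 < \<kappa>" "\<And>t. t1 \<le> t \<Longrightarrow> \<kappa> \<le> p_sq t 1"
    using p_sq_away_from_0 by blast
  have "eventually (\<lambda>x. loss x < e) at_top"
    using order_tendstoD(2)[OF loss_lim assms] .
  then obtain M where M: "loss M < e" by (auto simp: eventually_at_top_linorder)
  \<comment> \<open>A risk of at least \<open>e\<close> forces some sample to have loss at least
    \<open>e\<close>, hence margin at most \<open>M\<close>; \<open>r\<close> is the resulting lower
    bound on the rate.\<close>
  define r where "r = \<kappa> * (\<gamma> / real CARD('n) * c M)\<^sup>2"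
  have r: "0 < r" using t1 \<gamma>_pos c_pos[of M] by (simp add: r_def)
  have "\<exists>T\<ge>0. mean_loss (w T) < e"
  proof (rule ccontr)
    assume "\<not> ?thesis"
    then have ge: "\<And>t. 0 \<le> t \<Longrightarrow> e \<le> mean_loss (w t)" by force
    have rate: "r \<le> rate t" if t: "t1 \<le> t" for t
    proof -
      have "\<exists>i. e \<le> loss (inner (w t) (Z i))"
      proof (rule ccontr)
        assume "\<not> ?thesis"
        then have "(\<Sum>i\<in>UNIV. loss (inner (w t) (Z i))) < (\<Sum>i\<in>(UNIV::'n set). e)"
          by (intro sum_strict_mono) (auto simp: not_le)
        then have "mean_loss (w t) < e" by (simp add: mean_loss_def field_simps)
        then show False using ge[of t] t t1 by simp
      qed
      then obtain i where "e \<le> loss (inner (w t) (Z i))" ..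
      then have "inner (w t) (Z i) \<le> M" using M loss_less_iff[of "inner (w t) (Z i)" M] by force
      then have "c M \<le> c (inner (w t) (Z i))" by (rule c_antimono)
      then have "\<gamma> / real CARD('n) * c M \<le> norm (g t)"
        using \<gamma>_pos by (intro order_trans[OF mult_left_mono norm_g_ge]) auto
      then have "(\<gamma> / real CARD('n) * c M)\<^sup>2 \<le> (norm (g t))\<^sup>2"
        using \<gamma>_pos c_pos[of M] by (intro power_mono) auto
      then have "r \<le> p_sq t 1 * (norm (g t))\<^sup>2"
        using t1 t unfolding r_def by (intro mult_mono) (auto intro: p_sq_nonneg)
      then show ?thesis using rate_ge[of t] by linarith
    qed
    \<comment> \<open>By time \<open>b\<close> the risk would have lost at least
      \<open>mean_loss (w t1) + r\<close>, more than it had.\<close>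
    define b where "b = t1 + mean_loss (w t1) / r + 1"
    have b: "t1 < b" using mean_loss_pos[of "w t1"] r by (simp add: b_def add_pos_pos)
    obtain x where x: "x \<in> {t1<..<b}" "mean_loss (w b) - mean_loss (w t1) = - rate x * (b - t1)"
      using mvt_halfline[OF mean_loss_deriv, of t1 b] t1 b by auto
    have "r * (b - t1) \<le> rate x * (b - t1)" using rate[of x] x b by (intro mult_right_mono) auto
    moreover have "r * (b - t1) = mean_loss (w t1) + r" using r by (simp add: b_def field_simps)
    ultimately show False using x mean_loss_pos[of "w b"] r by simp
  qed
  then obtain T where "0 \<le> T" "mean_loss (w T) < e" by blast
  then have "mean_loss (w t) < e" if "T \<le> t" for t using mean_loss_antimono[of T t] that by simp
  then show ?thesis by (auto simp: eventually_at_top_linorder)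
qed

lemma margins_at_top: "eventually (\<lambda>t. \<forall>i. M \<le> inner (w t) (Z i)) at_top"
proof -
  \<comment> \<open>A mean loss below this threshold forces every single loss below
    \<open>loss M\<close>.\<close>
  have "0 < loss M / real CARD('n)" using loss_pos by simp
  from mean_loss_eventually_less[OF this] show ?thesis
  proof eventually_elim
    case (elim t)
    show ?case
    proof
      fix i
      have "loss (inner (w t) (Z i)) \<le> (\<Sum>i\<in>UNIV. loss (inner (w t) (Z i)))"
        by (rule member_le_sum) (auto intro: less_imp_le loss_pos)
      also have "\<dots> < loss M" using elim by (simp add: mean_loss_def field_simps)
      finally show "M \<le> inner (w t) (Z i)" unfolding loss_less_iff by simp
    qed
  qed
qed

section \<open>Divergence of the product vector and of the layers\<close>

lemma norm_w_at_top: "filterlim (\<lambda>t. norm (w t)) at_top at_top"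
  unfolding filterlim_at_top
proof
  fix K :: real
  \<comment> \<open>Any sample will do; adding 1 to its norm gives a positive factor to
    cancel.\<close>
  define i where "i = (undefined :: 'n)"
  have "eventually (\<lambda>t. \<forall>i'. \<bar>K\<bar> * (norm (Z i) + 1) \<le> inner (w t) (Z i')) at_top"
    by (rule margins_at_top)
  then show "eventually (\<lambda>t. K \<le> norm (w t)) at_top"
  proof eventually_elim
    case (elim t)
    have "\<bar>K\<bar> * (norm (Z i) + 1) \<le> inner (w t) (Z i)" using elim by simp
    also have "\<dots> \<le> norm (w t) * norm (Z i)" by (rule norm_cauchy_schwarz)
    also have "\<dots> \<le> norm (w t) * (norm (Z i) + 1)" by (intro mult_left_mono) auto
    finally have "\<bar>K\<bar> \<le> norm (w t)"
      by (rule mult_right_le_imp_le) (simp add: add_nonneg_pos)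
    then show ?case by simp
  qed
qed

lemma w_sq_le_prod: "(norm (w t))\<^sup>2 \<le> (\<Prod>k\<in>{1..L}. frob_sq t k)"
proof -
  have "(norm (w t))\<^sup>2 \<le> (\<Prod>l\<in>{Suc 1..L}. frob_sq t l) * frob_sq t 1"
    using p_sq_le_prod[of 1 t] L_ge
    by (intro order_trans[OF w_sq_le] mult_right_mono frob_sq_nonneg) auto
  then show ?thesis
    using L_ge by (simp add: prod.atLeast_Suc_atMost[of 1 L "frob_sq t"] mult.commute)
qed

lemma prod_frob_sq_at_top: "filterlim (\<lambda>t. \<Prod>k\<in>{1..L}. frob_sq t k) at_top at_top"
proof (rule filterlim_at_top_mono)
  show "filterlim (\<lambda>t. (norm (w t))\<^sup>2) at_top at_top"
    by (rule filterlim_pow_at_top[OF _ norm_w_at_top]) simp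
  show "eventually (\<lambda>t. (norm (w t))\<^sup>2 \<le> (\<Prod>k\<in>{1..L}. frob_sq t k)) at_top"
    by (simp add: w_sq_le_prod)
qed

text \<open>The product of the squared layer norms dominates |w|^2 and so diverges; were the last
  layer below \<open>S\<close>, all layers would be bounded, because their squared norms differ by
  constants.\<close>

lemma frob_sq_top_at_top: "filterlim (\<lambda>t. frob_sq t L) at_top at_top"
  unfolding filterlim_at_top
proof
  fix S :: real
  have "\<forall>k\<in>{1..L}. \<exists>c. \<forall>t\<ge>0. frob_sq t k = frob_sq t L + c" using frob_sq_bound by auto
  then obtain d where d: "\<And>k t. k \<in> {1..L} \<Longrightarrow> 0 \<le> t \<Longrightarrow> frob_sq t k = frob_sq t L + d k"
    by metis
  define B where "B = (\<Prod>k\<in>{1..L}. \<bar>S\<bar> + \<bar>d k\<bar>)"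
  show "eventually (\<lambda>t. S \<le> frob_sq t L) at_top"
    using filterlim_at_top_dense[THEN iffD1, OF prod_frob_sq_at_top, THEN spec, of B] eventually_ge_at_top[of 0]
  proof eventually_elim
    case (elim t)
    show ?case
    proof (rule ccontr)
      assume "\<not> S \<le> frob_sq t L"
      then have "(\<Prod>k\<in>{1..L}. frob_sq t k) \<le> B" unfolding B_def
      proof (intro prod_mono conjI frob_sq_nonneg)
        fix k assume "k \<in> {1..L}"
        then show "frob_sq t k \<le> \<bar>S\<bar> + \<bar>d k\<bar>"
          using d[of k t] elim \<open>\<not> S \<le> frob_sq t L\<close> by linarith
      qed
      then show False using elim by simp
    qed
  qed
qed

lemma frob_sq_one_at_top: "filterlim (\<lambda>t. frob_sq t 1) at_top at_top"
proof -
  obtain c1 where c1: "\<And>t. 0 \<le> t \<Longrightarrow> frob_sq t 1 = frob_sq t L + c1"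
    using frob_sq_bound[of 1] L_ge by auto
  show ?thesis
    unfolding filterlim_at_top
  proof
    fix S
    show "eventually (\<lambda>t. S \<le> frob_sq t 1) at_top"
      using filterlim_at_top[THEN iffD1, OF frob_sq_top_at_top, THEN spec, of "S - c1"] eventually_ge_at_top[of 0]
      by eventually_elim (simp add: c1)
  qed
qed

section \<open>The component orthogonal to the maximum margin direction\<close>

definition perp :: "real^'d \<Rightarrow> real^'d" where "perp v = v - inner v u *\<^sub>R u"

lemma inner_perp_u [simp]: "inner (perp v) u = 0"
  using norm_u by (simp add: perp_def inner_diff_left norm_eq_1)

lemma norm_perp_sq: "(norm (perp v))\<^sup>2 = (norm v)\<^sup>2 - (inner v u)\<^sup>2"
proof -
  have "inner u u = 1" using norm_u by (simp add: norm_eq_1)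
  then show ?thesis unfolding power2_norm_eq_inner perp_def
    by (simp add: inner_diff_left inner_diff_right inner_commute power2_eq_square)
qed

text \<open>Some support vector is opposed to \<open>perp v\<close>, so its nonnegative inner
  product with \<open>v\<close> must come from the component of \<open>v\<close> along
  \<open>u\<close>.\<close>

lemma inner_u_nonneg:
  assumes "\<And>i. 0 \<le> inner v (Z i)"
  shows "0 \<le> inner v u"
proof -
  obtain i where i: "inner u (Z i) = \<gamma>" "inner (perp v) (Z i) \<le> - \<epsilon> * norm (perp v)"
    using opposed[of "perp v"] by auto
  have "0 \<le> \<epsilon> * norm (perp v)" using \<epsilon>_pos by simp
  then have "0 \<le> inner v u * \<gamma>"
    using assms[of i] i by (simp add: perp_def inner_diff_left)
  then show ?thesis using \<gamma>_pos by (simp add: zero_le_mult_iff)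
qed

text \<open>The support vector opposed to \<open>perp v\<close> has a larger loss derivative than all data points
  on the side of \<open>perp v\<close>, and its contribution dominates once \<open>perp v\<close> is long.\<close>
lemma inner_perp_drisk_nonneg:
  assumes pos: "\<And>i. 0 \<le> inner v (Z i)" and large: "2 * real CARD('n) \<le> \<epsilon> * norm (perp v)"
  shows "0 \<le> inner (perp v) (drisk c Z v)"
proof -
  define a where "a = inner v u"
  \<comment> \<open>The exponential weight of a support vector whose inner product with
    \<open>perp v\<close> is zero.\<close>
  define A where "A = exp (- (a * \<gamma>))"
  define s where "s i = inner (perp v) (Z i)" for i
  have a: "0 \<le> a" unfolding a_def by (rule inner_u_nonneg[OF pos])
  have m: "inner v (Z i) = a * inner u (Z i) + s i" for i
    by (simp add: s_def perp_def a_def inner_diff_left)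
  \<comment> \<open>On the positive side the weight decays with \<open>s i\<close>, and s exp(-s) is
    at most 1, so a term cannot exceed \<open>A\<close> however large \<open>s i\<close> is.\<close>
  have le: "c (inner v (Z i)) * s i \<le> A" for i
  proof (cases "0 < s i")
    case True
    have "c (inner v (Z i)) \<le> exp (- inner v (Z i))" by (rule c_le[OF pos])
    also have "\<dots> \<le> exp (- (a * \<gamma>) - s i)"
      unfolding m using mult_left_mono[OF margin a, of i] by simp
    finally have "c (inner v (Z i)) * s i \<le> exp (- (a * \<gamma>) - s i) * s i"
      using True by (intro mult_right_mono) auto
    also have "\<dots> = A * (s i / exp (s i))" by (simp add: A_def exp_diff)
    also have "\<dots> \<le> A * 1"
    proof (rule mult_left_mono)
      show "s i / exp (s i) \<le> 1" using exp_ge_add_one_self[of "s i"] by (simp add: field_simps del: exp_ge_add_one_self)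
    qed (simp add: A_def)
    finally show ?thesis by simp
  next
    case False
    then have "c (inner v (Z i)) * s i \<le> 0" using c_pos[of "inner v (Z i)"] by (intro mult_nonneg_nonpos) auto
    then show ?thesis by (rule order_trans) (simp add: A_def)
  qed
  obtain j where j: "inner u (Z j) = \<gamma>" "s j \<le> - \<epsilon> * norm (perp v)"
    using opposed[of "perp v"] by (auto simp: s_def)
  \<comment> \<open>The 2 offsets the half in the lower bound for \<open>c\<close>; the number of
    samples then outweighs the other terms, each at most \<open>A\<close>.\<close>
  have sj: "s j \<le> - (2 * real CARD('n))" using j large by simp
  then have sj0: "s j \<le> 0" by (rule order_trans) simp
  have "A / 2 \<le> exp (- inner v (Z j)) / 2"
    unfolding A_def m j using sj0 by simp
  also have "\<dots> \<le> c (inner v (Z j))" by (rule c_ge[OF pos])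
  finally have "c (inner v (Z j)) * s j \<le> A / 2 * s j"
    using sj0 by (intro mult_right_mono_neg) auto
  also have "\<dots> \<le> A / 2 * (- (2 * real CARD('n)))"
    using sj by (intro mult_left_mono) (auto simp: A_def)
  finally have lej: "c (inner v (Z j)) * s j \<le> - (A * real CARD('n))" by simp
  have "(\<Sum>i\<in>UNIV. c (inner v (Z i)) * s i) = c (inner v (Z j)) * s j + (\<Sum>i\<in>UNIV - {j}. c (inner v (Z i)) * s i)"
    by (rule sum.remove) auto
  also have "\<dots> \<le> - (A * real CARD('n)) + (\<Sum>i\<in>UNIV - {j}. A)"
    by (intro add_mono lej sum_mono le)
  also have "\<dots> \<le> - (A * real CARD('n)) + A * real CARD('n)"
    by (simp add: A_def card_Diff_singleton)
  finally show ?thesis by (simp add: inner_drisk s_def mult_nonneg_nonpos divide_nonpos_pos)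
qed

definition "perp_sq t = (\<Sum>i<ds 1. (norm (perp (W1 t i)))\<^sup>2)"

lemma perp_sq_eq: "perp_sq t = frob_sq t 1 - (\<Sum>i<ds 1. (inner (W1 t i) u)\<^sup>2)"
  by (simp add: perp_sq_def norm_perp_sq frob_sq_one sum_subtractf)

lemma w_eq: "w t = (\<Sum>i<ds 1. p t 1 i *\<^sub>R W1 t i)"
  using L_ge by (simp add: wprod_one ds_top)

lemma frob_sq_one_deriv:
  assumes "0 \<le> t"
  shows "((\<lambda>s. frob_sq s 1) has_real_derivative - 2 * inner (w t) (g t)) (at t within {0..})"
proof -
  have "((\<lambda>s. \<Sum>a<ds 1. gram s 1 a a) has_real_derivative
     (\<Sum>a<ds 1. - (p t 1 a * inner (q t 1 a) (g t) + p t 1 a * inner (q t 1 a) (g t)))) (at t within {0..})"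
    using L_ge by (intro DERIV_sum gram_deriv assms) auto
  moreover have "(\<Sum>a<ds 1. - (p t 1 a * inner (q t 1 a) (g t) + p t 1 a * inner (q t 1 a) (g t))) = - 2 * inner (w t) (g t)"
    by (simp add: w_eq fprod_one inner_sum_left sum_distrib_left sum_negf sum.distrib mult_ac)
  ultimately show ?thesis by (simp add: frob_sq_def)
qed

lemma perp_sq_deriv:
  assumes "0 \<le> t"
  shows "(perp_sq has_real_derivative - 2 * inner (perp (w t)) (g t)) (at t within {0..})"
proof -
  have 1: "((\<lambda>s. inner (W1 s i) u) has_real_derivative - p t 1 i * inner (g t) u) (at t within {0..})" if "i < ds 1" for i
    using bounded_linear.has_vector_derivative[OF bounded_linear_inner_left W1_deriv[OF assms that], of u]
    by (simp add: has_real_derivative_iff_has_vector_derivative)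
  have "((\<lambda>s. \<Sum>i<ds 1. (inner (W1 s i) u)\<^sup>2) has_real_derivative
     (\<Sum>i<ds 1. 2 * (inner (W1 t i) u * (- p t 1 i * inner (g t) u)))) (at t within {0..})"
    by (intro DERIV_sum) (auto intro!: derivative_eq_intros 1)
  moreover have "(\<Sum>i<ds 1. 2 * (inner (W1 t i) u * (- p t 1 i * inner (g t) u))) = - 2 * (inner (w t) u * inner (g t) u)"
    by (simp add: w_eq inner_sum_left sum_distrib_left sum_distrib_right sum_negf algebra_simps)
  ultimately have "((\<lambda>s. frob_sq s 1 - (\<Sum>i<ds 1. (inner (W1 s i) u)\<^sup>2)) has_real_derivative
     - 2 * inner (w t) (g t) - - 2 * (inner (w t) u * inner (g t) u)) (at t within {0..})"
    by (intro DERIV_diff frob_sq_one_deriv[OF assms]) simp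
  then show ?thesis
    by (simp add: perp_sq_eq[abs_def] perp_def inner_diff_left inner_commute algebra_simps)
qed

text \<open>By Cauchy-Schwarz, the component of \<open>w t\<close> along \<open>u\<close> is limited
  by the part of W_1 along \<open>u\<close>. When |w| is nearly as large as the layer norms permit,
  a large orthogonal part of W_1 therefore forces a long \<open>perp (w t)\<close>.\<close>

lemma perp_w_lower:
  "(norm (w t))\<^sup>2 - p_sq t 1 * (frob_sq t 1 - perp_sq t) \<le> (norm (perp (w t)))\<^sup>2"
proof -
  have "(inner (w t) u)\<^sup>2 = (\<Sum>i<ds 1. p t 1 i * inner (W1 t i) u)\<^sup>2"
    by (simp add: w_eq inner_sum_left)
  also have "\<dots> \<le> p_sq t 1 * (frob_sq t 1 - perp_sq t)"
    unfolding perp_sq_eq p_sq_def using Cauchy_Schwarz_ineq_sum by simp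
  finally show ?thesis by (simp add: norm_perp_sq)
qed

lemma perp_w_upper: "(norm (perp (w t)))\<^sup>2 \<le> p_sq t 1 * perp_sq t"
proof -
  have "perp (w t) = (\<Sum>i<ds 1. p t 1 i *\<^sub>R perp (W1 t i))"
    by (simp add: perp_def w_eq inner_sum_left scaleR_diff_right sum_subtractf scaleR_sum_left)
  then show ?thesis unfolding perp_sq_def p_sq_def by (simp only: norm_sum_scaleR_square_le)
qed

section \<open>Limits of the orthogonal share of W_1, of the direction and of the singular
  vector\<close>

abbreviation "frob_prod t \<equiv> \<Prod>k\<in>{1..L}. frob_sq t k"

lemma p_sq_frob_sq_le: "p_sq t 1 * frob_sq t 1 \<le> frob_prod t"
  using mult_right_mono[OF p_sq_le_prod[of 1 t] frob_sq_nonneg[of t 1]] L_ge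
  by (simp add: prod.atLeast_Suc_atMost[of 1 L "frob_sq t"] mult.commute)

lemma perp_sq_le: "perp_sq t \<le> frob_sq t 1"
  unfolding perp_sq_eq by (simp add: sum_nonneg)

lemma perp_sq_nonneg: "0 \<le> perp_sq t"
  unfolding perp_sq_def by (intro sum_nonneg) auto

lemma norm_w_ratio': "((\<lambda>t. (norm (w t))\<^sup>2 / frob_prod t) \<longlongrightarrow> 1) at_top"
  by (rule norm_w_ratio[OF frob_sq_top_at_top])

text \<open>The squared norm of W_1 eventually does not decrease since all margins are nonnegative.
  That of its orthogonal part does not grow while it is a fixed fraction of the whole, because
  \<open>perp (w t)\<close> is then long enough for \<open>inner_perp_drisk_nonneg\<close>.\<close>

lemma perp_ratio: "((\<lambda>t. perp_sq t / frob_sq t 1) \<longlongrightarrow> 0) at_top"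
proof (rule ratio_tendsto_0_of_derivs[OF frob_sq_one_deriv perp_sq_deriv])
  show "eventually (\<lambda>t. 0 \<le> - 2 * inner (w t) (g t)) at_top"
    using margins_at_top[of 0]
  proof eventually_elim
    case (elim t)
    have "0 \<le> (\<Sum>i\<in>UNIV. c (inner (w t) (Z i)) * inner (w t) (Z i))"
      using elim c_pos by (intro sum_nonneg mult_nonneg_nonneg) (auto intro: less_imp_le)
    then show ?case by (simp add: g_eq inner_drisk)
  qed
next
  fix e :: real assume e: "0 < e"
  \<comment> \<open>The square of the length that \<open>inner_perp_drisk_nonneg\<close> asks of
    \<open>perp (w t)\<close>.\<close>
  define B where "B = (2 * real CARD('n) / \<epsilon>)\<^sup>2"
  have "eventually (\<lambda>t. 1 - e / 2 < (norm (w t))\<^sup>2 / frob_prod t) at_top"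
    using order_tendstoD(1)[OF norm_w_ratio', of "1 - e / 2"] e by simp
  moreover have "eventually (\<lambda>t. max 0 (2 * B / e) < frob_prod t) at_top"
    using filterlim_at_top_dense[THEN iffD1, OF prod_frob_sq_at_top] by blast
  moreover have "eventually (\<lambda>t. 0 < frob_sq t 1) at_top"
    using filterlim_at_top_dense[THEN iffD1, OF frob_sq_one_at_top] by blast
  ultimately show "eventually (\<lambda>t. e * frob_sq t 1 \<le> perp_sq t \<longrightarrow> - 2 * inner (perp (w t)) (g t) \<le> 0) at_top"
    using margins_at_top[of 0]
  proof eventually_elim
    case (elim t)
    show ?case
    proof
      assume large: "e * frob_sq t 1 \<le> perp_sq t"
      have P: "0 < frob_prod t" "2 * B / e < frob_prod t" using elim(2) by auto
      \<comment> \<open>This makes the factor \<open>1 - e\<close> below nonnegative.\<close>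
      have "e * frob_sq t 1 \<le> frob_sq t 1" using large perp_sq_le[of t] by linarith
      then have e1: "e \<le> 1" using elim(3) by simp
      have "p_sq t 1 * (frob_sq t 1 - perp_sq t) \<le> p_sq t 1 * ((1 - e) * frob_sq t 1)"
        using large by (intro mult_left_mono p_sq_nonneg) (simp add: algebra_simps)
      also have "\<dots> = (1 - e) * (p_sq t 1 * frob_sq t 1)" by simp
      also have "\<dots> \<le> (1 - e) * frob_prod t"
        using e1 by (intro mult_left_mono p_sq_frob_sq_le) auto
      finally have 1: "p_sq t 1 * (frob_sq t 1 - perp_sq t) \<le> (1 - e) * frob_prod t" .
      \<comment> \<open>Imperfect alignment loses at most a share \<open>e / 2\<close> of the
        product, whereas the orthogonal part holds a share \<open>e\<close> of W_1; the difference
        is left for \<open>perp (w t)\<close>.\<close>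
      have "(1 - e / 2) * frob_prod t \<le> (norm (w t))\<^sup>2"
        using elim(1) unfolding pos_less_divide_eq[OF P(1)] by (rule less_imp_le)
      with 1 perp_w_lower[of t] have "e / 2 * frob_prod t \<le> (norm (perp (w t)))\<^sup>2"
        by (simp add: algebra_simps)
      moreover have "B \<le> e / 2 * frob_prod t" using P e by (simp add: field_simps)
      ultimately have "B \<le> (norm (perp (w t)))\<^sup>2" by linarith
      then have "2 * real CARD('n) / \<epsilon> \<le> norm (perp (w t))"
        unfolding B_def by (rule power2_le_imp_le) simp
      then have "2 * real CARD('n) \<le> \<epsilon> * norm (perp (w t))"
        using \<epsilon>_pos by (simp add: field_simps)
      from inner_perp_drisk_nonneg[OF _ this] elim(4) show "- 2 * inner (perp (w t)) (g t) \<le> 0"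
        by (simp add: g_eq)
    qed
  qed
qed (auto intro: perp_sq_nonneg frob_sq_one_at_top)

text \<open>Alignment sends the squared norm of the rescaled vector to 1, and
  \<open>perp_ratio\<close> its orthogonal component to 0, so its component along \<open>u\<close>
  tends to 1 in absolute value; nonnegative margins settle the sign.\<close>

theorem direction_tendsto:
  "((\<lambda>t. (1 / (\<Prod>k\<in>{1..L}. frob ds (W1 t) (W t) k)) *\<^sub>R w t) \<longlongrightarrow> u) at_top"
proof -
  define b where "b t = (1 / (\<Prod>k\<in>{1..L}. frob ds (W1 t) (W t) k)) *\<^sub>R w t" for t
  have "(\<Prod>k\<in>A. sqrt (frob_sq t k)) = sqrt (\<Prod>k\<in>A. frob_sq t k)" for A t
    by (induction A rule: infinite_finite_induct) (auto simp: real_sqrt_mult)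
  then have prod: "(\<Prod>k\<in>{1..L}. frob ds (W1 t) (W t) k) = sqrt (frob_prod t)" for t
    by (simp add: frob_eq)
  have P0: "0 \<le> frob_prod t" for t by (intro prod_nonneg) (simp add: frob_sq_nonneg)
  have nb: "(norm (b t))\<^sup>2 = (norm (w t))\<^sup>2 / frob_prod t" for t
    using P0[of t] by (simp add: b_def prod power_divide power_mult_distrib)
  have pb: "perp (b t) = (1 / sqrt (frob_prod t)) *\<^sub>R perp (w t)" for t
    by (simp add: b_def prod perp_def scaleR_diff_right)
  have npb: "(norm (perp (b t)))\<^sup>2 = (norm (perp (w t)))\<^sup>2 / frob_prod t" for t
    using P0[of t] by (simp add: pb power_divide power_mult_distrib)
  have "((\<lambda>t. (norm (perp (b t)))\<^sup>2) \<longlongrightarrow> 0) at_top"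
  proof (rule Lim_null_comparison[OF _ perp_ratio])
    show "eventually (\<lambda>t. norm ((norm (perp (b t)))\<^sup>2) \<le> perp_sq t / frob_sq t 1) at_top"
      using filterlim_at_top_dense[THEN iffD1, OF frob_sq_one_at_top, THEN spec, of 0]
        filterlim_at_top_dense[THEN iffD1, OF prod_frob_sq_at_top, THEN spec, of 0]
    proof eventually_elim
      case (elim t)
      have "(norm (perp (w t)))\<^sup>2 * frob_sq t 1 \<le> p_sq t 1 * perp_sq t * frob_sq t 1"
        using elim by (intro mult_right_mono perp_w_upper) auto
      also have "\<dots> = perp_sq t * (p_sq t 1 * frob_sq t 1)" by simp
      also have "\<dots> \<le> perp_sq t * frob_prod t"
        by (intro mult_left_mono p_sq_frob_sq_le perp_sq_nonneg)
      finally show ?case unfolding npb using elim by (simp add: field_simps)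
    qed
  qed
  from tendsto_diff[OF norm_w_ratio' this]
  have "((\<lambda>t. (inner (b t) u)\<^sup>2) \<longlongrightarrow> 1) at_top"
    unfolding norm_perp_sq nb by simp
  then have "((\<lambda>t. \<bar>inner (b t) u\<bar>) \<longlongrightarrow> 1) at_top"
    using tendsto_real_sqrt by fastforce
  moreover have "eventually (\<lambda>t. \<bar>inner (b t) u\<bar> = inner (b t) u) at_top"
    using margins_at_top[of 0]
  proof eventually_elim
    case (elim t)
    have "0 \<le> inner (w t) u" using elim by (intro inner_u_nonneg) auto
    then show ?case using P0[of t] by (simp add: b_def prod)
  qed
  ultimately have bu: "((\<lambda>t. inner (b t) u) \<longlongrightarrow> 1) at_top"
    by (rule Lim_transform_eventually)
  have "((\<lambda>t. (norm (b t))\<^sup>2 - 2 * inner (b t) u + 1) \<longlongrightarrow> 1 - 2 * 1 + 1) at_top"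
    unfolding nb by (intro tendsto_intros bu norm_w_ratio')
  moreover have "(norm (b t))\<^sup>2 - 2 * inner (b t) u + 1 = (norm (b t - u))\<^sup>2" for t
  proof -
    have "inner u u = 1" using norm_u by (simp add: norm_eq_1)
    then show ?thesis unfolding power2_norm_eq_inner
      by (simp add: inner_diff_left inner_diff_right inner_commute)
  qed
  ultimately have "((\<lambda>t. (norm (b t - u))\<^sup>2) \<longlongrightarrow> 0) at_top" by simp
  from tendsto_real_sqrt[OF this] have "((\<lambda>t. norm (b t - u)) \<longlongrightarrow> 0) at_top" by simp
  then have "(b \<longlongrightarrow> u) at_top"
    by (simp only: tendsto_norm_zero_iff LIM_zero_iff)
  then show ?thesis by (simp add: b_def[abs_def])
qed

text \<open>Maximality of \<open>v\<close> gives |W_1 u| <= |W_1 v|. Splitting the rows along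
  \<open>u\<close> bounds the right side by |<v, u>| |W_1 u| plus the norm of the orthogonal part;
  then divide by |W_1 u|.\<close>

lemma top_rsv_lower:
  assumes "top_rsv ds (W1 t) v" and "perp_sq t < frob_sq t 1"
  shows "1 - sqrt (perp_sq t / (frob_sq t 1 - perp_sq t)) \<le> \<bar>inner v u\<bar>"
proof -
  define a where "a = inner v u"
  define X where "X = (\<Sum>i<ds 1. (inner (W1 t i) u)\<^sup>2)"
  have X: "X = frob_sq t 1 - perp_sq t" "0 < X" using assms by (auto simp: X_def perp_sq_eq)
  have nv: "norm v = 1" using assms by (simp add: top_rsv_def)
  have split: "inner (W1 t i) v = a * inner (W1 t i) u + inner (perp (W1 t i)) v" for i
    by (simp add: perp_def a_def inner_diff_left inner_diff_right inner_commute)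
  have "sqrt X \<le> L2_set (\<lambda>i. inner (W1 t i) v) {..<ds 1}"
    using assms norm_u unfolding X_def L2_set_def top_rsv_def by simp
  also have "\<dots> \<le> L2_set (\<lambda>i. a * inner (W1 t i) u) {..<ds 1} + L2_set (\<lambda>i. inner (perp (W1 t i)) v) {..<ds 1}"
    unfolding split by (rule L2_set_triangle_ineq)
  also have "L2_set (\<lambda>i. a * inner (W1 t i) u) {..<ds 1} = \<bar>a\<bar> * sqrt X"
    by (simp add: L2_set_def X_def power_mult_distrib sum_distrib_left[symmetric] real_sqrt_mult)
  also have "L2_set (\<lambda>i. inner (perp (W1 t i)) v) {..<ds 1} \<le> sqrt (perp_sq t)"
    unfolding L2_set_def perp_sq_def
  proof (intro real_sqrt_le_mono sum_mono)
    fix i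
    have "\<bar>inner (perp (W1 t i)) v\<bar> \<le> norm (perp (W1 t i))"
      using Cauchy_Schwarz_ineq2[of "perp (W1 t i)" v] nv by simp
    then have "\<bar>inner (perp (W1 t i)) v\<bar>\<^sup>2 \<le> (norm (perp (W1 t i)))\<^sup>2" by (intro power_mono) auto
    then show "(inner (perp (W1 t i)) v)\<^sup>2 \<le> (norm (perp (W1 t i)))\<^sup>2" by simp
  qed
  finally have "sqrt X \<le> \<bar>a\<bar> * sqrt X + sqrt (perp_sq t)" by simp
  then show ?thesis using X(2) unfolding X(1)[symmetric] a_def[symmetric]
    by (simp add: real_sqrt_divide field_simps)
qed

theorem top_rsv_tendsto:
  assumes v: "\<And>t. 0 \<le> t \<Longrightarrow> top_rsv ds (W1 t) (v t)"
  shows "((\<lambda>t. \<bar>inner (v t) u\<bar>) \<longlongrightarrow> 1) at_top"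
proof (rule tendsto_sandwich)
  have F: "eventually (\<lambda>t. 0 < frob_sq t 1) at_top"
    using filterlim_at_top_dense[THEN iffD1, OF frob_sq_one_at_top] by blast
  have h: "eventually (\<lambda>t. perp_sq t / frob_sq t 1 < 1) at_top"
    using order_tendstoD(2)[OF perp_ratio, of 1] by simp
  show "eventually (\<lambda>t. 1 - sqrt (perp_sq t / (frob_sq t 1 - perp_sq t)) \<le> \<bar>inner (v t) u\<bar>) at_top"
    using F h eventually_ge_at_top[of 0]
    by eventually_elim (intro top_rsv_lower v, auto simp: field_simps)
  show "eventually (\<lambda>t. \<bar>inner (v t) u\<bar> \<le> 1) at_top"
    using eventually_ge_at_top[of 0]
  proof eventually_elim
    case (elim t)
    then show ?case using v[of t] Cauchy_Schwarz_ineq2[of "v t" u] norm_u by (simp add: top_rsv_def)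
  qed
  have "((\<lambda>t. 1 - sqrt ((perp_sq t / frob_sq t 1) / (1 - perp_sq t / frob_sq t 1))) \<longlongrightarrow> 1 - sqrt (0 / (1 - 0))) at_top"
    by (intro tendsto_intros perp_ratio) auto
  moreover have "eventually (\<lambda>t. 1 - sqrt ((perp_sq t / frob_sq t 1) / (1 - perp_sq t / frob_sq t 1))
     = 1 - sqrt (perp_sq t / (frob_sq t 1 - perp_sq t))) at_top"
    using F
  proof eventually_elim
    case (elim t)
    have "1 - perp_sq t / frob_sq t 1 = (frob_sq t 1 - perp_sq t) / frob_sq t 1"
      using elim by (simp add: diff_divide_distrib)
    then show ?case using elim by simp
  qed
  ultimately show "((\<lambda>t. 1 - sqrt (perp_sq t / (frob_sq t 1 - perp_sq t))) \<longlongrightarrow> 1) at_top"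
    by (simp add: Lim_transform_eventually)
qed simp

end

section \<open>Generic data\<close>

text \<open>The norm-minimal point of the convex hull of the data is \<open>\<gamma>\<close> times the maximum margin direction.\<close>
lemma max_margin_dir_in_hull:
  fixes Z :: "'n::finite \<Rightarrow> real^'d"
  assumes sep: "separable Z" and ub: "max_margin_dir Z ub"
  shows "0 < min_margin Z ub" "min_margin Z ub *\<^sub>R ub \<in> convex hull (range Z)"
proof -
  define S where "S = convex hull (range Z)"
  have S: "convex S" "closed S" "S \<noteq> {}"
    unfolding S_def by (auto intro!: compact_imp_closed finite_imp_compact_convex_hull)
  have ZS: "Z i \<in> S" for i unfolding S_def by (rule hull_inc) simp
  define r where "r = closest_point S 0"
  have rS: "r \<in> S" unfolding r_def using S closest_point_in_set by blast
  have r_le: "inner r r \<le> inner r x" if "x \<in> S" for x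
    using closest_point_dot[OF S(1,2) that, of 0] by (simp add: r_def inner_diff_right)
  have hull: "a \<le> inner v x" if "x \<in> S" "\<And>i. a \<le> inner v (Z i)" for a v x
  proof -
    have "S \<subseteq> {x. a \<le> inner v x}" unfolding S_def
      by (rule hull_minimal) (use that convex_halfspace_ge[of a v] in auto)
    then show ?thesis using that by auto
  qed
  have minm: "a \<le> min_margin Z v" if "\<And>i. a \<le> inner v (Z i)" for a v
    unfolding min_margin_def using that by (intro Min.boundedI) auto
  have margin: "min_margin Z v \<le> inner v (Z i)" for v i
    unfolding min_margin_def by (intro Min_le) auto
  obtain v where v: "\<And>i. 0 < inner v (Z i)" using sep by (auto simp: separable_def)
  have "0 < min_margin Z v" unfolding min_margin_def using v by (subst Min_gr_iff) auto
  also have "\<dots> \<le> inner v r" by (rule hull[OF rS margin])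
  finally have r0: "r \<noteq> 0" by auto
  then have nr: "0 < norm r" by simp
  have nub: "norm ub = 1" using ub by (simp add: max_margin_dir_def)
  \<comment> \<open>By minimality every data point has inner product at least |r|^2 with
    \<open>r\<close>, so the normalized \<open>r\<close> has margin at least |r|.\<close>
  have "norm r \<le> min_margin Z (r /\<^sub>R norm r)"
  proof (rule minm)
    fix i
    show "norm r \<le> inner (r /\<^sub>R norm r) (Z i)"
      using r_le[OF ZS, of i] nr by (simp add: field_simps power2_norm_eq_inner[symmetric] power2_eq_square)
  qed
  also have "\<dots> \<le> min_margin Z ub"
    using ub r0 by (simp add: max_margin_dir_def)
  finally have 1: "norm r \<le> min_margin Z ub" .
  have 2: "min_margin Z ub \<le> inner ub r" by (rule hull[OF rS margin])
  have 3: "inner ub r \<le> norm r" using norm_cauchy_schwarz[of ub r] nub by simp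
  \<comment> \<open>The three bounds close up to a chain of equalities, and equality in
    Cauchy-Schwarz makes \<open>r\<close> a positive multiple of \<open>ub\<close>.\<close>
  have "norm ub *\<^sub>R r = norm r *\<^sub>R ub"
    using 1 2 3 nub norm_cauchy_schwarz_eq[of ub r] by simp
  moreover have "min_margin Z ub = norm r" using 1 2 3 by linarith
  ultimately have "min_margin Z ub *\<^sub>R ub = r" using nub by simp
  then show "min_margin Z ub *\<^sub>R ub \<in> convex hull (range Z)" using rS by (simp add: S_def)
  show "0 < min_margin Z ub" using 1 nr by linarith
qed

text \<open>Coefficients are indexed by samples rather than by points, which allows for repeated
  data points. The combinations of this form are a convex set containing all
  \<open>Z j\<close>.\<close>

lemma convex_hull_range_coeffs:
  fixes Z :: "'n::finite \<Rightarrow> 'a::real_vector"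
  assumes "x \<in> convex hull (range Z)"
  obtains \<alpha> where "\<And>i. 0 \<le> \<alpha> i" "sum \<alpha> UNIV = 1" "x = (\<Sum>i\<in>UNIV. \<alpha> i *\<^sub>R Z i)"
proof -
  define A where "A = {x. \<exists>\<alpha>. (\<forall>i. 0 \<le> \<alpha> i) \<and> sum \<alpha> UNIV = 1 \<and> x = (\<Sum>i\<in>UNIV. \<alpha> i *\<^sub>R Z i)}"
  have "convex A"
  proof (rule convexI)
    fix x y :: 'a and a b :: real
    assume xy: "x \<in> A" "y \<in> A" and ab: "0 \<le> a" "0 \<le> b" "a + b = 1"
    from xy obtain \<alpha> \<beta> where
      "\<And>i. 0 \<le> \<alpha> i" "sum \<alpha> UNIV = 1" "x = (\<Sum>i\<in>UNIV. \<alpha> i *\<^sub>R Z i)"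
      "\<And>i. 0 \<le> \<beta> i" "sum \<beta> UNIV = 1" "y = (\<Sum>i\<in>UNIV. \<beta> i *\<^sub>R Z i)"
      unfolding A_def by auto
    then show "a *\<^sub>R x + b *\<^sub>R y \<in> A" using ab unfolding A_def
      by (intro CollectI exI[of _ "\<lambda>i. a * \<alpha> i + b * \<beta> i"])
        (auto simp: sum.distrib sum_distrib_left[symmetric] scaleR_add_left scaleR_sum_right)
  qed
  moreover have "Z j \<in> A" for j
    unfolding A_def
    by (intro CollectI exI[of _ "\<lambda>i. if i = j then 1 else 0"])
      (auto simp: if_distrib[where f = "\<lambda>x. x *\<^sub>R _"] cong: if_cong)
  ultimately have "convex hull (range Z) \<subseteq> A" by (intro hull_minimal) auto
  then show ?thesis using assms that unfolding A_def by blast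
qed

text \<open>Fubini for the indicator of \<open>A\<close> at \<open>x + s *\<^sub>R v\<close>:
  integrating over \<open>s\<close> first gives 0, since each line meets \<open>A\<close> at most
  once; integrating over \<open>x\<close> first gives the measure of \<open>A\<close> by translation
  invariance.\<close>

lemma null_if_lines_meet_once:
  fixes A :: "'a::euclidean_space set"
  assumes A: "A \<in> sets borel" and line: "\<And>x s. x \<in> A \<Longrightarrow> x + s *\<^sub>R v \<in> A \<Longrightarrow> s = 0"
  shows "emeasure lborel A = 0"
proof -
  \<comment> \<open>Confining \<open>s\<close> to an interval of length 1 makes the second iterated
    integral equal to the measure of \<open>A\<close> itself.\<close>
  define f :: "real \<Rightarrow> 'a \<Rightarrow> ennreal" where "f s x = indicator {0..1} s * indicator A (x + s *\<^sub>R v)" for s x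
  have [measurable]: "A \<in> sets borel" by (rule A)
  have meas: "case_prod f \<in> borel_measurable (lborel \<Otimes>\<^sub>M lborel)"
    unfolding f_def by measurable
  have line0: "emeasure lborel {s. x + s *\<^sub>R v \<in> A} = 0" for x
  proof -
    have "{s. x + s *\<^sub>R v \<in> A} \<subseteq> {SOME s. x + s *\<^sub>R v \<in> A}"
    proof
      fix s assume s: "s \<in> {s. x + s *\<^sub>R v \<in> A}"
      then have "x + (SOME s. x + s *\<^sub>R v \<in> A) *\<^sub>R v \<in> A" by (auto intro: someI)
      then have "(SOME s. x + s *\<^sub>R v \<in> A) - s = 0"
        using s by (intro line[of "x + s *\<^sub>R v"]) (auto simp: algebra_simps)
      then show "s \<in> {SOME s. x + s *\<^sub>R v \<in> A}" by simp
    qed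
    then have "countable {s. x + s *\<^sub>R v \<in> A}" by (rule countable_subset) simp
    then show ?thesis by (rule emeasure_lborel_countable)
  qed
  have "(\<integral>\<^sup>+ s. f s x \<partial>lborel) = 0" for x
  proof -
    have [measurable]: "{s. x + s *\<^sub>R v \<in> A} \<in> sets borel" by measurable
    have "(\<integral>\<^sup>+ s. f s x \<partial>lborel) \<le> (\<integral>\<^sup>+ s. indicator {s. x + s *\<^sub>R v \<in> A} s \<partial>lborel)"
      unfolding f_def by (intro nn_integral_mono) (auto split: split_indicator)
    also have "\<dots> = 0" using line0[of x] by simp
    finally show ?thesis by simp
  qed
  then have "0 = (\<integral>\<^sup>+ x. (\<integral>\<^sup>+ s. f s x \<partial>lborel) \<partial>lborel)" by simp
  also have "\<dots> = (\<integral>\<^sup>+ s. (\<integral>\<^sup>+ x. f s x \<partial>lborel) \<partial>lborel)"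
    by (rule lborel_pair.Fubini'[OF meas])
  also have "\<dots> = (\<integral>\<^sup>+ s. indicator {0..1::real} s * emeasure lborel A \<partial>lborel)"
  proof (rule nn_integral_cong)
    fix s :: real
    have "emeasure lborel A = (\<integral>\<^sup>+ x. indicator A x \<partial>distr lborel borel ((+) (s *\<^sub>R v)))"
      by (subst lborel_distr_plus) simp
    also have "\<dots> = (\<integral>\<^sup>+ x. indicator A (x + s *\<^sub>R v) \<partial>lborel)"
      by (subst nn_integral_distr) (auto simp: add.commute)
    finally show "(\<integral>\<^sup>+ x. f s x \<partial>lborel) = indicator {0..1} s * emeasure lborel A"
      unfolding f_def by (subst nn_integral_cmult) auto
  qed
  also have "\<dots> = emeasure lborel A" by (simp add: nn_integral_multc)
  finally show ?thesis by simp
qed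

text \<open>Here \<open>p\<close> is the norm-minimal point of the hull of the \<open>z\<^sub>k\<close>, \<open>k \<in> T\<close>; it is determined by these
  \<open>z\<^sub>k\<close>, and \<open>z\<^sub>i\<close> lies on the hyperplane through \<open>p\<close> orthogonal to \<open>p\<close>.\<close>
definition degenerate_coeffs :: "('n::finite \<Rightarrow> real) \<Rightarrow> 'n set \<Rightarrow> 'n \<Rightarrow> 'd::finite \<Rightarrow> real^'d^'n \<Rightarrow> real^'n \<Rightarrow> bool" where
  "degenerate_coeffs y T i b X \<alpha> \<longleftrightarrow>
     (\<forall>k. 0 \<le> \<alpha> $ k) \<and> (\<Sum>k\<in>UNIV. \<alpha> $ k) = 1 \<and> (\<forall>k\<in>- T. \<alpha> $ k = 0) \<and>
     (let p = (\<Sum>k\<in>UNIV. \<alpha> $ k *\<^sub>R zvec y X k) in \<forall>k\<in>insert i T. inner p (zvec y X k) = inner p p)"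

text \<open>The coordinate \<open>b\<close> witnesses that p is nonzero and is the direction in
  which z_i is moved in \<open>degenerate_null\<close>.\<close>

definition degenerate :: "('n::finite \<Rightarrow> real) \<Rightarrow> 'n set \<Rightarrow> 'n \<Rightarrow> 'd::finite \<Rightarrow> (real^'d^'n) set" where
  "degenerate y T i b = {X. \<exists>\<alpha>. degenerate_coeffs y T i b X \<alpha> \<and> (\<Sum>k\<in>UNIV. \<alpha> $ k *\<^sub>R zvec y X k) $ b \<noteq> 0}"

text \<open>The quantifier over coefficients is a projection, and projections of compact sets are
  compact. Bounding the data and keeping the coordinate \<open>b\<close> of p at distance 1/(m+1)
  from zero exhausts the set by countably many of them.\<close>

lemma degenerate_borel:
  fixes y :: "'n::finite \<Rightarrow> real" and b :: "'d::finite"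
  shows "(degenerate y T i b :: (real^'d^'n) set) \<in> sets borel"
proof -
  define p where "p X \<alpha> = (\<Sum>k\<in>UNIV. \<alpha> $ k *\<^sub>R zvec y X k)" for X :: "real^'d^'n" and \<alpha> :: "real^'n"
  define K where "K m = {(X :: real^'d^'n, \<alpha> :: real^'n). degenerate_coeffs y T i b X \<alpha> \<and>
      norm X \<le> real m \<and> 1 / real (Suc m) \<le> \<bar>p X \<alpha> $ b\<bar>}" for m :: nat
  have "closed (K m)" for m
    unfolding K_def degenerate_coeffs_def p_def zvec_def Let_def case_prod_beta Ball_def
    by (intro closed_Collect_conj closed_Collect_all closed_Collect_imp open_Collect_const
        closed_Collect_le closed_Collect_eq continuous_intros)
  moreover have "bounded (K m)" for m
  proof (rule bounded_subset)
    show "bounded (cball (0 :: real^'d^'n) (real m) \<times> cball (0 :: real^'n) (real CARD('n)))"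
      by (intro bounded_Times bounded_cball)
    show "K m \<subseteq> cball 0 (real m) \<times> cball 0 (real CARD('n))"
    proof clarify
      fix X \<alpha> assume X: "(X, \<alpha>) \<in> K m"
      then have \<alpha>: "\<And>k. 0 \<le> \<alpha> $ k" "(\<Sum>k\<in>UNIV. \<alpha> $ k) = 1" by (auto simp: K_def degenerate_coeffs_def)
      have "norm \<alpha> \<le> (\<Sum>k\<in>UNIV. \<bar>\<alpha> $ k\<bar>)" by (rule norm_le_l1_cart)
      also have "\<dots> = 1" using \<alpha> by simp
      also have "1 \<le> real CARD('n)" by (simp add: Suc_leI One_nat_def)
      finally show "X \<in> cball 0 (real m) \<and> \<alpha> \<in> cball 0 (real CARD('n))" using X by (simp add: K_def)
    qed
  qed
  ultimately have "compact (K m)" for m by (simp add: compact_eq_bounded_closed)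
  then have "compact (fst ` K m)" for m
    by (rule compact_continuous_image[rotated]) (intro continuous_intros)
  then have "fst ` K m \<in> sets borel" for m by (intro borel_closed compact_imp_closed)
  then have "(\<Union>m. fst ` K m) \<in> sets borel" by auto
  moreover have "degenerate y T i b = (\<Union>m. fst ` K m)"
  proof (intro set_eqI iffI)
    fix X :: "real^'d^'n" assume "X \<in> degenerate y T i b"
    then obtain \<alpha> where \<alpha>: "degenerate_coeffs y T i b X \<alpha>" "p X \<alpha> $ b \<noteq> 0"
      by (auto simp: degenerate_def p_def)
    obtain m1 :: nat where m1: "norm X \<le> real m1" using real_arch_simple by blast
    obtain m2 :: nat where m2: "inverse (real (Suc m2)) < \<bar>p X \<alpha> $ b\<bar>"
      using reals_Archimedean[of "\<bar>p X \<alpha> $ b\<bar>"] \<alpha> by auto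
    have "1 / real (Suc (max m1 m2)) \<le> inverse (real (Suc m2))" by (simp add: divide_simps)
    then have "(X, \<alpha>) \<in> K (max m1 m2)" using \<alpha> m1 m2 by (auto simp: K_def)
    then show "X \<in> (\<Union>m. fst ` K m)" by (force intro: rev_image_eqI)
  next
    fix X :: "real^'d^'n" assume "X \<in> (\<Union>m. fst ` K m)"
    then obtain m \<alpha> where K: "(X, \<alpha>) \<in> K m" by auto
    have "0 < 1 / real (Suc m)" by simp
    then have "p X \<alpha> $ b \<noteq> 0" using K unfolding K_def by auto
    then show "X \<in> degenerate y T i b" using K by (auto simp: degenerate_def K_def p_def)
  qed
  ultimately show ?thesis by simp
qed

text \<open>Moving z_i along coordinate \<open>b\<close> leaves p unchanged, as p depends on the
  points in \<open>T\<close> only. The hyperplane condition fixes <p, z_i>, and p has a nonzero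
  coordinate \<open>b\<close>, so the shift must vanish.\<close>

lemma degenerate_null:
  fixes y :: "'n::finite \<Rightarrow> real" and b :: "'d::finite"
  assumes i: "i \<notin> T" and y: "y i \<noteq> 0"
  shows "emeasure lborel (degenerate y T i b :: (real^'d^'n) set) = 0"
proof (rule null_if_lines_meet_once[OF degenerate_borel, where v = "axis i (axis b 1)"])
  fix X :: "real^'d^'n" and s :: real
  define X' where "X' = X + s *\<^sub>R axis i (axis b 1)"
  assume "X \<in> degenerate y T i b" "X + s *\<^sub>R axis i (axis b 1) \<in> degenerate y T i b"
  then obtain \<alpha> \<beta> where \<alpha>: "degenerate_coeffs y T i b X \<alpha>" "(\<Sum>k\<in>UNIV. \<alpha> $ k *\<^sub>R zvec y X k) $ b \<noteq> 0"
    and \<beta>: "degenerate_coeffs y T i b X' \<beta>"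
    unfolding degenerate_def X'_def by auto
  define p where "p = (\<Sum>k\<in>UNIV. \<alpha> $ k *\<^sub>R zvec y X k)"
  define p' where "p' = (\<Sum>k\<in>UNIV. \<beta> $ k *\<^sub>R zvec y X' k)"
  have z: "zvec y X' k = zvec y X k" if "k \<in> T" for k
    using that i by (auto simp: zvec_def X'_def axis_def)
  have zi: "zvec y X' i = zvec y X i + (y i * s) *\<^sub>R axis b 1"
    by (simp add: zvec_def X'_def axis_def scaleR_add_right)
  have a: "(\<Sum>k\<in>UNIV. \<alpha> $ k) = 1" "\<And>k. k \<notin> T \<Longrightarrow> \<alpha> $ k = 0"
      "\<And>k. k \<in> insert i T \<Longrightarrow> inner p (zvec y X k) = inner p p"
    using \<alpha>(1) by (auto simp: degenerate_coeffs_def p_def Let_def)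
  have b: "(\<Sum>k\<in>UNIV. \<beta> $ k) = 1" "\<And>k. k \<notin> T \<Longrightarrow> \<beta> $ k = 0"
      "\<And>k. k \<in> insert i T \<Longrightarrow> inner p' (zvec y X' k) = inner p' p'"
    using \<beta>(1) by (auto simp: degenerate_coeffs_def p'_def Let_def)
  \<comment> \<open>p and p' are averages of the same points, and each has constant inner product
    with them; so <p', p> equals |p'|^2 and, symmetrically, |p|^2.\<close>
  have "inner p' p = (\<Sum>k\<in>UNIV. \<alpha> $ k * inner p' (zvec y X k))"
    by (simp add: p_def inner_sum_right)
  also have "\<dots> = (\<Sum>k\<in>UNIV. \<alpha> $ k * inner p' p')"
  proof (rule sum.cong[OF refl])
    fix k show "\<alpha> $ k * inner p' (zvec y X k) = \<alpha> $ k * inner p' p'"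
      using a(2)[of k] b(3)[of k] z[of k] by (cases "k \<in> T") auto
  qed
  also have "\<dots> = inner p' p'" using a(1) by (simp add: sum_distrib_right[symmetric])
  finally have 1: "inner p' p = inner p' p'" .
  have "inner p p' = (\<Sum>k\<in>UNIV. \<beta> $ k * inner p (zvec y X' k))"
    by (simp add: p'_def inner_sum_right)
  also have "\<dots> = (\<Sum>k\<in>UNIV. \<beta> $ k * inner p p)"
  proof (rule sum.cong[OF refl])
    fix k show "\<beta> $ k * inner p (zvec y X' k) = \<beta> $ k * inner p p"
      using b(2)[of k] a(3)[of k] z[of k] by (cases "k \<in> T") auto
  qed
  also have "\<dots> = inner p p" using b(1) by (simp add: sum_distrib_right[symmetric])
  finally have 2: "inner p p' = inner p p" .
  have "inner (p - p') (p - p') = 0" using 1 2 by (simp add: inner_diff_left inner_diff_right inner_commute)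
  then have "p = p'" by simp
  then have "inner p (zvec y X' i) = inner p (zvec y X i)" using a(3)[of i] b(3)[of i] by simp
  then have "y i * s * p $ b = 0" by (simp add: zi inner_add_right inner_axis)
  then show "s = 0" using y \<alpha>(2) by (simp add: p_def)
qed

text \<open>The spanning condition and genericity combine here: a counterexample
  \<open>\<xi>\<close> would put a support vector outside \<open>T\<close> on the hyperplane
  determined by \<open>T\<close>.\<close>

lemma opposed_support_vector:
  fixes X :: "real^'d^'n::finite"
  assumes sep: "separable (zvec y X)" and ub: "max_margin_dir (zvec y X) ub"
    and span: "span (support_vectors (zvec y X) ub) = UNIV"
    and gen: "\<And>T i b. i \<notin> T \<Longrightarrow> X \<notin> degenerate y T i b"
    and \<xi>: "inner \<xi> ub = 0" "\<xi> \<noteq> 0"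
  shows "\<exists>i. inner ub (zvec y X i) = min_margin (zvec y X) ub \<and> inner \<xi> (zvec y X i) < 0"
proof (rule ccontr)
  define Z where "Z = zvec y X"
  define \<gamma> where "\<gamma> = min_margin Z ub"
  assume "\<not> ?thesis"
  then have nonneg: "\<And>i. inner ub (Z i) = \<gamma> \<Longrightarrow> 0 \<le> inner \<xi> (Z i)"
    by (force simp: Z_def \<gamma>_def)
  have nub: "inner ub ub = 1" using ub by (simp add: max_margin_dir_def norm_eq_1)
  have \<gamma>: "0 < \<gamma>" "\<gamma> *\<^sub>R ub \<in> convex hull (range Z)"
    using max_margin_dir_in_hull[OF sep ub] by (auto simp: \<gamma>_def Z_def)
  from convex_hull_range_coeffs[OF \<gamma>(2)] obtain \<alpha> where
    \<alpha>: "\<And>i. 0 \<le> \<alpha> i" "sum \<alpha> UNIV = 1" "\<gamma> *\<^sub>R ub = (\<Sum>i\<in>UNIV. \<alpha> i *\<^sub>R Z i)" by blast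
  have margin: "\<gamma> \<le> inner ub (Z i)" for i
    unfolding min_margin_def \<gamma>_def by (intro Min_le) auto
  define T where "T = {k. 0 < \<alpha> k}"
  \<comment> \<open>Complementary slackness: the margins average to \<open>\<gamma>\<close> under
    the weights \<open>\<alpha>\<close>, so points of positive weight attain it.\<close>
  have "(\<Sum>k\<in>UNIV. \<alpha> k * (inner ub (Z k) - \<gamma>)) = inner ub (\<Sum>i\<in>UNIV. \<alpha> i *\<^sub>R Z i) - sum \<alpha> UNIV * \<gamma>"
    by (simp add: right_diff_distrib sum_subtractf inner_sum_right sum_distrib_right)
  also have "\<dots> = 0" using nub \<alpha>(2) unfolding \<alpha>(3)[symmetric] by simp
  finally have "\<forall>k\<in>UNIV. \<alpha> k * (inner ub (Z k) - \<gamma>) = 0"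
    using \<alpha>(1) margin by (subst (asm) sum_nonneg_eq_0_iff) auto
  then have T_support: "inner ub (Z k) = \<gamma>" if "k \<in> T" for k
    using that by (force simp: T_def)
  \<comment> \<open>Likewise the inner products with \<open>\<xi>\<close> average to zero, and those
    of positive weight are nonnegative.\<close>
  have "(\<Sum>k\<in>UNIV. \<alpha> k * inner \<xi> (Z k)) = inner \<xi> (\<gamma> *\<^sub>R ub)"
    unfolding \<alpha>(3) by (simp add: inner_sum_right)
  also have "\<dots> = 0" using \<xi> by simp
  finally have "\<forall>k\<in>UNIV. \<alpha> k * inner \<xi> (Z k) = 0"
  proof (subst (asm) sum_nonneg_eq_0_iff)
    fix k show "0 \<le> \<alpha> k * inner \<xi> (Z k)"
    proof (cases "k \<in> T")
      case True then show ?thesis using \<alpha>(1)[of k] nonneg[OF T_support] by simp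
    next
      case False
      then have "\<alpha> k = 0" using \<alpha>(1)[of k] by (simp add: T_def)
      then show ?thesis by simp
    qed
  qed auto
  then have T_orth: "inner \<xi> (Z k) = 0" if "k \<in> T" for k using that by (force simp: T_def)
  \<comment> \<open>A vector orthogonal to a spanning set is zero, so \<open>\<xi>\<close> is
    nonzero on some support vector.\<close>
  obtain i where i: "inner ub (Z i) = \<gamma>" "inner \<xi> (Z i) \<noteq> 0"
  proof (rule ccontr)
    assume "\<not> thesis"
    then have "\<And>x. x \<in> support_vectors Z ub \<Longrightarrow> inner \<xi> x = 0"
      using that by (auto simp: support_vectors_def \<gamma>_def)
    then have "support_vectors Z ub \<subseteq> {x. inner \<xi> x = 0}" by auto
    then have "span (support_vectors Z ub) \<subseteq> {x. inner \<xi> x = 0}"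
      by (rule span_minimal) (rule subspace_hyperplane)
    then have "\<xi> \<in> {x. inner \<xi> x = 0}" using span unfolding Z_def[symmetric] by blast
    then show False using \<xi> by simp
  qed
  have iT: "i \<notin> T" using i T_orth by auto
  have "ub \<noteq> 0" using nub by auto
  then obtain b where b: "ub $ b \<noteq> 0" by (auto simp: vec_eq_iff)
  have p: "(\<Sum>k\<in>UNIV. vec_lambda \<alpha> $ k *\<^sub>R zvec y X k) = \<gamma> *\<^sub>R ub"
    by (simp add: \<alpha>(3) Z_def)
  have "degenerate_coeffs y T i b X (vec_lambda \<alpha>)"
    unfolding degenerate_coeffs_def Let_def p
    using \<alpha>(1,2) T_support i(1) nub by (auto simp: T_def Z_def not_less intro: antisym)
  moreover have "(\<Sum>k\<in>UNIV. vec_lambda \<alpha> $ k *\<^sub>R zvec y X k) $ b \<noteq> 0"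
    unfolding p using b \<gamma> by simp
  ultimately have "X \<in> degenerate y T i b" unfolding degenerate_def by blast
  then show False using gen[OF iT] by blast
qed

text \<open>Compactness of the unit sphere in the complement of \<open>u\<close> makes the strict
  inequality uniform. The sum of negative parts is continuous and positive exactly when some
  admissible point is opposed; scaling covers all other nonzero \<open>\<xi>\<close>.\<close>

lemma uniformly_opposed:
  fixes Z :: "'n::finite \<Rightarrow> real^'d" and u :: "real^'d"
  assumes ex: "\<exists>i. P i"
    and opp: "\<And>\<xi>. inner \<xi> u = 0 \<Longrightarrow> \<xi> \<noteq> 0 \<Longrightarrow> \<exists>i. P i \<and> inner \<xi> (Z i) < 0"
  obtains \<epsilon> where "0 < \<epsilon>" "\<And>\<xi>. inner \<xi> u = 0 \<Longrightarrow> \<exists>i. P i \<and> inner \<xi> (Z i) \<le> - \<epsilon> * norm \<xi>"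
proof -
  define S where "S = {\<xi>. norm \<xi> = 1 \<and> inner \<xi> u = 0}"
  define h where "h \<xi> = (\<Sum>i\<in>{i. P i}. max 0 (- inner \<xi> (Z i)))" for \<xi>
  have ne: "{i. P i} \<noteq> {}" using ex by auto
  have "S = sphere 0 1 \<inter> {\<xi>. inner u \<xi> = 0}" by (auto simp: S_def inner_commute)
  then have comp: "compact S" by (simp add: compact_Int_closed closed_hyperplane)
  have h_pos: "0 < h \<xi>" if "\<xi> \<in> S" for \<xi>
  proof -
    have "\<xi> \<noteq> 0" "inner \<xi> u = 0" using that by (auto simp: S_def)
    then obtain i where "P i" "inner \<xi> (Z i) < 0" using opp by blast
    then show ?thesis unfolding h_def by (intro sum_pos2[of _ i]) auto
  qed
  obtain \<delta> where \<delta>: "0 < \<delta>" "\<And>\<xi>. \<xi> \<in> S \<Longrightarrow> \<delta> \<le> h \<xi>"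
  proof (cases "S = {}")
    \<comment> \<open>There may be no unit vector orthogonal to \<open>u\<close>, as for nonzero
      \<open>u\<close> in dimension one.\<close>
    case True then show ?thesis using that[of 1] by auto
  next
    case False
    have "continuous_on S h" unfolding h_def by (intro continuous_intros)
    from continuous_attains_inf[OF comp False this] show ?thesis using that h_pos by blast
  qed
  \<comment> \<open>Of at most \<open>CARD('n)\<close> summands of \<open>h\<close>, one reaches
    their mean.\<close>
  define \<epsilon> where "\<epsilon> = \<delta> / real CARD('n)"
  have \<epsilon>: "0 < \<epsilon>" using \<delta> by (simp add: \<epsilon>_def)
  have unit: "\<exists>i. P i \<and> inner \<xi> (Z i) \<le> - \<epsilon>" if "\<xi> \<in> S" for \<xi>
  proof (rule ccontr)
    assume "\<not> ?thesis"
    then have "h \<xi> < (\<Sum>i\<in>{i. P i}. \<epsilon>)"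
      unfolding h_def using \<epsilon> ne by (intro sum_strict_mono) force+
    also have "\<dots> \<le> real CARD('n) * \<epsilon>"
      using \<epsilon> by (simp add: card_mono)
    also have "\<dots> = \<delta>" by (simp add: \<epsilon>_def)
    finally show False using \<delta>(2)[OF that] by simp
  qed
  have "\<exists>i. P i \<and> inner \<xi> (Z i) \<le> - \<epsilon> * norm \<xi>" if "inner \<xi> u = 0" for \<xi>
  proof (cases "\<xi> = 0")
    case True then show ?thesis using ex by simp
  next
    case False
    then have "\<xi> /\<^sub>R norm \<xi> \<in> S" using that by (simp add: S_def)
    then obtain i where "P i" "inner (\<xi> /\<^sub>R norm \<xi>) (Z i) \<le> - \<epsilon>" using unit by blast
    then show ?thesis using False by (intro exI[of _ i]) (simp add: field_simps)
  qed
  then show ?thesis using that \<epsilon> by blast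
qed

lemma AE_not_degenerate:
  fixes y :: "'n::finite \<Rightarrow> real"
  assumes "\<And>i. y i \<noteq> 0"
  shows "AE X in (lborel :: (real^'d^'n) measure). \<forall>T i b. i \<notin> T \<longrightarrow> X \<notin> degenerate y T i b"
proof -
  have "AE X in (lborel :: (real^'d^'n) measure). i \<notin> T \<longrightarrow> X \<notin> degenerate y T i b" for T i b
  proof (cases "i \<in> T")
    case False
    have "degenerate y T i b \<in> null_sets (lborel :: (real^'d^'n) measure)"
      using degenerate_null[OF False, of y b] assms degenerate_borel[of y T i b] by (auto intro: null_setsI)
    then show ?thesis using AE_not_in by fastforce
  qed simp
  then show ?thesis by (simp add: AE_all_countable)
qed

section \<open>Loss functions and trajectories\<close>

lemma has_vector_derivative_vec_componentwise:
  fixes f :: "real \<Rightarrow> real^'d"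
  assumes "\<And>j. ((\<lambda>s. f s $ j) has_real_derivative f' $ j) (at t within A)"
  shows "(f has_vector_derivative f') (at t within A)"
  unfolding has_vector_derivative_def
proof (subst has_derivative_componentwise_within, rule ballI)
  fix b :: "real^'d" assume "b \<in> Basis"
  then obtain j where "b = axis j 1" by (auto simp: Basis_vec_def)
  then show "((\<lambda>s. inner (f s) b) has_derivative (\<lambda>s. inner (s *\<^sub>R f') b)) (at t within A)"
    using assms[of j] by (simp add: has_field_derivative_def inner_axis mult.commute[of _ "f' $ j"])
qed

text \<open>For the logistic loss, \<open>c x\<close> is \<open>exp (- x)\<close> divided by a
  number between 1 and 2 when x is nonnegative, which gives the two-sided comparison.\<close>

lemma exp_or_logistic_loss:
  fixes loss :: "real \<Rightarrow> real"
  assumes "loss = (\<lambda>x. exp (- x)) \<or> loss = (\<lambda>x. ln (1 + exp (- x)))"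
  obtains c where "\<And>x. (loss has_real_derivative - c x) (at x)" "\<And>x. 0 < c x"
    "\<And>x x'. x \<le> x' \<Longrightarrow> c x' \<le> c x" "\<And>x. 0 \<le> x \<Longrightarrow> c x \<le> exp (- x)"
    "\<And>x. 0 \<le> x \<Longrightarrow> exp (- x) / 2 \<le> c x" "\<And>x. 0 < loss x" "(loss \<longlongrightarrow> 0) at_top"
proof -
  have lim: "((\<lambda>x :: real. exp (- x)) \<longlongrightarrow> 0) at_top"
    by (rule filterlim_compose[OF exp_at_bot filterlim_uminus_at_bot_at_top])
  from assms show ?thesis
  proof
    assume l: "loss = (\<lambda>x. exp (- x))"
    have "((\<lambda>x. exp (- x)) has_real_derivative - exp (- x)) (at x)" for x :: real
      by (auto intro!: derivative_eq_intros)
    then show ?thesis using lim by (intro that[of "\<lambda>x. exp (- x)"]) (auto simp: l)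
  next
    assume l: "loss = (\<lambda>x. ln (1 + exp (- x)))"
    have pos: "0 < 1 + exp x" for x :: real by (simp add: add_pos_pos)
    define c where "c x = exp (- x) / (1 + exp (- x))" for x :: real
    have c: "c x = 1 / (1 + exp x)" for x
      using pos[of x] pos[of "-x"] by (simp add: c_def field_simps exp_minus)
    have "(loss has_real_derivative - c x) (at x)" for x
      unfolding l c_def using pos[of "-x"] by (auto intro!: derivative_eq_intros)
    moreover have "0 < c x" for x using pos[of x] by (simp add: c)
    moreover have "c x' \<le> c x" if "x \<le> x'" for x x'
      using that pos[of x] by (simp add: c frac_le)
    moreover have "c x \<le> exp (- x)" for x
      using pos[of "-x"] by (simp add: c_def field_simps)
    moreover have "exp (- x) / 2 \<le> c x" if "0 \<le> x" for x
      unfolding c_def using that by (intro divide_left_mono) (auto simp: add_pos_pos)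
    moreover have "0 < loss x" for x by (simp add: l ln_gt_zero)
    moreover have "((\<lambda>x :: real. ln (1 + exp (- x))) \<longlongrightarrow> ln (1 + 0)) at_top"
      by (intro tendsto_intros lim) auto
    then have "(loss \<longlongrightarrow> 0) at_top" by (simp add: l)
    ultimately show ?thesis by (rule that)
  qed
qed

text \<open>A nonzero partial derivative has both its factors nonzero, so the term of its layer is
  positive, and all other terms are nonnegative.\<close>

lemma (in deep_linear_flow) init_rate_pos:
  assumes "(\<exists>i<ds 1. \<exists>j. p t 1 i * g t $ j \<noteq> 0) \<or>
    (\<exists>k\<in>{2..L}. \<exists>i<ds k. \<exists>j<ds (k - 1). p t k i * inner (q t (k - 1) j) (g t) \<noteq> 0)"
  shows "0 < p_sq t 1 * (norm (g t))\<^sup>2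
    + (\<Sum>k\<in>{2..L}. p_sq t k * (\<Sum>j<ds (k - 1). (inner (q t (k - 1) j) (g t))\<^sup>2))"
proof -
  have p_pos: "0 < p_sq t k" if "i < ds k" "p t k i \<noteq> 0" for k i
    unfolding p_sq_def using that by (intro sum_pos2[of _ i]) auto
  have A: "0 \<le> p_sq t 1 * (norm (g t))\<^sup>2" by (simp add: p_sq_nonneg)
  have B: "0 \<le> p_sq t k * (\<Sum>j<ds (k - 1). (inner (q t (k - 1) j) (g t))\<^sup>2)" for k
    by (intro mult_nonneg_nonneg p_sq_nonneg sum_nonneg) auto
  from assms show ?thesis
  proof (elim disjE)
    assume "\<exists>i<ds 1. \<exists>j. p t 1 i * g t $ j \<noteq> 0"
    then obtain i j where "i < ds 1" "p t 1 i \<noteq> 0" "g t $ j \<noteq> 0" by auto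
    then have "0 < p_sq t 1 * (norm (g t))\<^sup>2" using p_pos[of i 1] by (auto simp: zero_less_mult_iff)
    then show ?thesis using B by (simp add: add_pos_nonneg sum_nonneg)
  next
    assume "\<exists>k\<in>{2..L}. \<exists>i<ds k. \<exists>j<ds (k - 1). p t k i * inner (q t (k - 1) j) (g t) \<noteq> 0"
    then obtain k i j where k: "k \<in> {2..L}" "i < ds k" "j < ds (k - 1)"
      and ne: "p t k i \<noteq> 0" "inner (q t (k - 1) j) (g t) \<noteq> 0" by auto
    have "0 < (\<Sum>j<ds (k - 1). (inner (q t (k - 1) j) (g t))\<^sup>2)"
      using k ne by (intro sum_pos2[of _ j]) auto
    then have "0 < p_sq t k * (\<Sum>j<ds (k - 1). (inner (q t (k - 1) j) (g t))\<^sup>2)"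
      using p_pos[OF k(2) ne(1)] by simp
    then have "0 < (\<Sum>k\<in>{2..L}. p_sq t k * (\<Sum>j<ds (k - 1). (inner (q t (k - 1) j) (g t))\<^sup>2))"
      using k(1) B by (intro sum_pos2[of _ k]) auto
    then show ?thesis using A by linarith
  qed
qed

theorem mainTheorem4:
  fixes L :: nat and ds :: "nat \<Rightarrow> nat" and y :: "'n::finite \<Rightarrow> real" and loss :: "real \<Rightarrow> real"
  assumes "L \<ge> 2" and "ds L = 1" and "\<forall>k\<in>{1..<L}. ds k \<ge> 1"
    and "\<forall>i. y i \<in> {-1, 1}"
    and "loss = (\<lambda>x. exp (- x)) \<or> loss = (\<lambda>x. ln (1 + exp (- x)))"
  shows "AE X in (lborel :: (real^'d^'n) measure).
     ((\<forall>i. norm (X $ i) \<le> 1) \<and> separable (zvec y X)) \<longrightarrow>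
     (\<forall>ub. max_margin_dir (zvec y X) ub \<longrightarrow> span (support_vectors (zvec y X) ub) = UNIV \<longrightarrow>
       (\<forall>W1 W. grad_flow loss y X ds L W1 W
          \<and> grad_nonzero loss y X ds L (W1 0) (W 0)
          \<and> risk loss y X ds L (W1 0) (W 0) \<le> loss 0 \<longrightarrow>
          ((\<lambda>t. (1 / (\<Prod>k\<in>{1..L}. frob ds (W1 t) (W t) k)) *\<^sub>R wprod ds L (W1 t) (W t)) \<longlongrightarrow> ub) at_top
          \<and> (\<forall>v1. (\<forall>t\<ge>0. top_rsv ds (W1 t) (v1 t)) \<longrightarrow>
                 ((\<lambda>t. \<bar>inner (v1 t) ub\<bar>) \<longlongrightarrow> 1) at_top)))"
proof -
  obtain c where c: "\<And>x. (loss has_real_derivative - c x) (at x)" "\<And>x. 0 < c x"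
    "\<And>x x'. x \<le> x' \<Longrightarrow> c x' \<le> c x" "\<And>x. 0 \<le> x \<Longrightarrow> c x \<le> exp (- x)"
    "\<And>x. 0 \<le> x \<Longrightarrow> exp (- x) / 2 \<le> c x" "\<And>x. 0 < loss x" "(loss \<longlongrightarrow> 0) at_top"
    using exp_or_logistic_loss[OF assms(5)] by metis
  have y: "y i \<noteq> 0" for i using assms(4) by (metis empty_iff insert_iff neg_equal_0_iff_equal zero_neq_one)
  have L: "1 \<le> L" using assms(1) by simp
  \<comment> \<open>The exceptional null set depends on the labels only, so it serves all
    trajectories at once.\<close>
  have "AE X in (lborel :: (real^'d^'n) measure). \<forall>T i b. i \<notin> T \<longrightarrow> X \<notin> degenerate y T i b"
    by (rule AE_not_degenerate[OF y])
  then show ?thesis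
  proof (rule eventually_mono, intro impI allI)
    fix X :: "real^'d^'n" and ub W1 W
    assume gen: "\<forall>T i b. i \<notin> T \<longrightarrow> X \<notin> degenerate y T i b"
      and data: "(\<forall>i. norm (X $ i) \<le> 1) \<and> separable (zvec y X)"
      and ub: "max_margin_dir (zvec y X) ub"
      and span: "span (support_vectors (zvec y X) ub) = UNIV"
      and run: "grad_flow loss y X ds L W1 W
          \<and> grad_nonzero loss y X ds L (W1 0) (W 0)
          \<and> risk loss y X ds L (W1 0) (W 0) \<le> loss 0"
    from data have sep: "separable (zvec y X)" ..
    from run have flow: "grad_flow loss y X ds L W1 W"
      and init: "grad_nonzero loss y X ds L (W1 0) (W 0)" "risk loss y X ds L (W1 0) (W 0) \<le> loss 0"
      by auto
    define Z where "Z = zvec y X"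
    define \<gamma> where "\<gamma> = min_margin Z ub"
    define g where "g t = drisk c Z (wprod ds L (W1 t) (W t))" for t
    have pd1: "pd1 loss y X ds L (W1 t) (W t) i j = bprod ds L (W t) 1 i * g t $ j" if "i < ds 1" for t i j
      using pd1_eq[OF c(1) L assms(2) that] by (simp add: g_def Z_def)
    have pdk: "pdk loss y X ds L (W1 t) (W t) k i j =
        bprod ds L (W t) k i * inner (fprod ds (W1 t) (W t) (k - 1) j) (g t)"
      if "2 \<le> k" "k \<le> L" "i < ds k" "j < ds (k - 1)" for t k i j
      using pdk_eq[OF c(1) assms(2) that] by (simp add: g_def Z_def)
    interpret F: deep_linear_flow L ds W1 W g
    proof
      fix t :: real and i assume t: "0 \<le> t" and i: "i < ds 1"
      show "((\<lambda>s. W1 s i) has_vector_derivative - bprod ds L (W t) 1 i *\<^sub>R g t) (at t within {0..})"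
      proof (rule has_vector_derivative_vec_componentwise)
        fix j
        have "((\<lambda>s. W1 s i $ j) has_real_derivative - pd1 loss y X ds L (W1 t) (W t) i j) (at t within {0..})"
          using flow t i unfolding grad_flow_def by blast
        then show "((\<lambda>s. W1 s i $ j) has_real_derivative (- bprod ds L (W t) 1 i *\<^sub>R g t) $ j) (at t within {0..})"
          by (simp add: pd1[OF i])
      qed
    next
      fix t :: real and k i j assume a: "0 \<le> t" "2 \<le> k" "k \<le> L" "i < ds k" "j < ds (k - 1)"
      have "((\<lambda>s. W s k i j) has_real_derivative - pdk loss y X ds L (W1 t) (W t) k i j) (at t within {0..})"
        using flow a unfolding grad_flow_def by auto
      then show "((\<lambda>s. W s k i j) has_real_derivative
          - (bprod ds L (W t) k i * inner (fprod ds (W1 t) (W t) (k - 1) j) (g t))) (at t within {0..})"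
        by (simp add: pdk[OF a(2-)])
    qed (use assms in auto)
    have margin: "\<gamma> \<le> inner ub (Z i)" for i
      unfolding min_margin_def \<gamma>_def by (intro Min_le) auto
    \<comment> \<open>The minimum margin is attained; the resulting support vector covers
      \<open>\<xi> = 0\<close> in \<open>opposed\<close>.\<close>
    have "\<gamma> \<in> range (\<lambda>i. inner ub (Z i))"
      unfolding \<gamma>_def min_margin_def by (intro Min_in) auto
    then have support: "\<exists>i. inner ub (Z i) = \<gamma>" by auto
    have gen': "\<And>T i b. i \<notin> T \<Longrightarrow> X \<notin> degenerate y T i b" using gen by blast
    obtain \<epsilon> where \<epsilon>: "0 < \<epsilon>"
      "\<And>\<xi>. inner \<xi> ub = 0 \<Longrightarrow> \<exists>i. inner ub (Z i) = \<gamma> \<and> inner \<xi> (Z i) \<le> - \<epsilon> * norm \<xi>"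
      using uniformly_opposed[where P = "\<lambda>i. inner ub (Z i) = \<gamma>" and u = ub and Z = Z, OF support]
        opposed_support_vector[OF sep ub span gen'] unfolding Z_def \<gamma>_def by blast
    have init_grad: "(\<exists>i<ds 1. \<exists>j. bprod ds L (W 0) 1 i * g 0 $ j \<noteq> 0) \<or>
      (\<exists>k\<in>{2..L}. \<exists>i<ds k. \<exists>j<ds (k - 1).
        bprod ds L (W 0) k i * inner (fprod ds (W1 0) (W 0) (k - 1) j) (g 0) \<noteq> 0)"
      using init(1) unfolding grad_nonzero_def by (elim disj_forward) (force simp: pd1, force simp: pdk)
    interpret S: separable_deep_linear_flow L ds W1 W g loss c Z ub \<gamma> \<epsilon>
    proof
      show "(1 / real CARD('n)) * (\<Sum>i\<in>UNIV. loss (inner (wprod ds L (W1 0) (W 0)) (Z i))) \<le> loss 0"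
        using init(2) by (simp add: risk_def Z_def)
      show "norm ub = 1" using ub by (simp add: max_margin_dir_def)
      show "0 < \<gamma>" using max_margin_dir_in_hull(1)[OF sep ub] by (simp add: \<gamma>_def Z_def)
    qed (use c margin \<epsilon> F.init_rate_pos[OF init_grad] in \<open>auto simp: g_def\<close>)
    show "((\<lambda>t. (1 / (\<Prod>k\<in>{1..L}. frob ds (W1 t) (W t) k)) *\<^sub>R wprod ds L (W1 t) (W t)) \<longlongrightarrow> ub) at_top
          \<and> (\<forall>v1. (\<forall>t\<ge>0. top_rsv ds (W1 t) (v1 t)) \<longrightarrow>
                 ((\<lambda>t. \<bar>inner (v1 t) ub\<bar>) \<longlongrightarrow> 1) at_top)"
      using S.direction_tendsto S.top_rsv_tendsto by blast
  qed
qed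

end
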